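(* Let $\underline C=(C_1,\dots,C_d)$ be a coisometric tuple on a Hilbert space $\mathcal H_C$ and let $\underline E=(E_1,\dots,E_d)$ be a coisometric lifting of $\underline C$ on a Hilbert space $\mathcal H_E\supset\mathcal H_C$. With the Hilbert spaces $\widehat{\mathcal H}_C,\widehat{\mathcal H}_E$, the unitaries $\tilde U_n, U_n$ and the orthogonal projections $P_n,Q_n$ ($n\ge 1$) defined in the context, the limit in the strong operator topology $$\widehat W:=\text{sot-}\lim_{n\to\infty}\tilde U_1^*\cdots\tilde U_n^*\,P_n\,U_n\cdots U_1$$ exists, and $\widehat W:\widehat{\mathcal H}_E\to\widehat{\mathcal H}_C$ is a coisometry. Its adjoint $\widehat W^*:\widehat{\mathcal H}_C\to\widehat{\mathcal H}_E$ is given by $$\widehat W^*=\text{sot-}\lim_{n\to\infty}U_1^*\cdots U_n^*\,\tilde U_n\cdots\tilde U_1\,Q_n .$$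
   Context: Let $d\ge 1$ be finite. For a tuple $\underline T=(T_1,\dots,T_d)$ of bounded operators on a Hilbert space $\mathcal L$: $\underline T$ is a row contraction if $\sum_j T_jT_j^*\le I$, and coisometric if $\sum_jT_jT_j^*=I$. For a row contraction, regarded as a row operator $\underline T:\bigoplus_1^d\mathcal L\to\mathcal L$, put $D_T=(I-\underline T^*\underline T)^{1/2}:\bigoplus_1^d\mathcal L\to\bigoplus_1^d\mathcal L$, let $\mathcal D_T$ be the closure of the range of $D_T$, and let $(D_T)_j:\mathcal L\to\mathcal D_T$ be $(D_T)_j\ell=D_T(0,\dots,\ell,\dots,0)$ with $\ell$ in the $j$-th component; $(D_T)_j^*:\mathcal D_T\to\mathcal L$ is its adjoint. A coisometric tuple $\underline E$ on $\mathcal H_E\supset\mathcal H_C$ is a coisometric lifting of $\underline C$ if, with respect to $\mathcal H_E=\mathcal H_C\oplus\mathcal H_C^\perp$, $E_j=\begin{pmatrix}C_j&0\\ B_j&A_j\end{pmatrix}$ for $j=1,\dots,d$ (equivalently $E_j^*\tilde h=C_j^*\tilde h$ for $\tilde h\in\mathcal H_C$). $\tilde\Lambda$ is the free semigroup (with empty word $\emptyset$) on $1,\dots,d$; $|\alpha|$ is the length of a word $\alpha$. $\Gamma=\bigoplus_{m\ge0}(\mathbb C^d)^{\otimes m}$ is the full Fock space with orthonormal basis $e_\alpha=e_{\alpha_1}\otimes\cdots\otimes e_{\alpha_m}$, $\alpha=\alpha_1\cdots\alpha_m\in\tilde\Lambda$, where $\{e_1,\dots,e_d\}$ is the standard basis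 of $\mathbb C^d$ and $e_\emptyset$ is the vacuum vector. Put $\widehat{\mathcal H}_C=\mathcal H_C\oplus(\Gamma\otimes\mathcal D_C)$ and $\widehat{\mathcal H}_E=\mathcal H_E\oplus(\Gamma\otimes\mathcal D_E)$. Let $\mathcal P$ be a $d$-dimensional Hilbert space with orthonormal basis $\epsilon_1,\dots,\epsilon_d$, and $\mathcal P_{[1,n]}=\mathcal P^{\otimes n}$ (for $n=0$: $\mathcal P_{[1,0]}=\mathbb C$). For $n\ge1$ the unitary $$\tilde U_n:\mathcal H_C\otimes\mathcal P_{[1,n-1]}\oplus\bigoplus_{m\ge n-1}\big((\mathbb C^d)^{\otimes m}\otimes\mathcal D_C\big)\to\mathcal H_C\otimes\mathcal P_{[1,n]}\oplus\bigoplus_{m\ge n}\big((\mathbb C^d)^{\otimes m}\otimes\mathcal D_C\big)$$ is defined by $$\tilde U_n\Big(\sum_{j_1,\dots,j_{n-1}}\tilde h_{j_1\cdots j_{n-1}}\otimes\epsilon_{j_1}\otimes\cdots\otimes\epsilon_{j_{n-1}}\oplus\sum_{j_1,\dots,j_{n-1}}e_{j_1}\otimes\cdots\otimes e_{j_{n-1}}\otimes y_{j_1\cdots j_{n-1}}\oplus\sum_{|\alpha|\ge n}e_\alpha\otimes y_\alpha\Big)$$ $$=\sum_{j_1,\dots,j_n}\big(C_{j_n}^*\tilde h_{j_1\cdots j_{n-1}}+(D_C)_{j_n}^*y_{j_1\cdots j_{n-1}}\big)\otimes\epsilon_{j_1}\otimes\cdots\otimes\epsilon_{j_n}\oplus\sum_{|\alpha|\ge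 n}e_\alpha\otimes y_\alpha ,$$ with $\tilde h_{\cdots}\in\mathcal H_C$, $y_{\cdots}\in\mathcal D_C$, all indices running over $1,\dots,d$. For $n=1$ this reads $\tilde U_1:\widehat{\mathcal H}_C\to\mathcal H_C\otimes\mathcal P\oplus\bigoplus_{m\ge1}((\mathbb C^d)^{\otimes m}\otimes\mathcal D_C)$, $\tilde U_1(\tilde h\oplus\sum_\alpha e_\alpha\otimes y_\alpha)=\sum_j(C_j^*\tilde h+(D_C)_j^*y_\emptyset)\otimes\epsilon_j\oplus\sum_{|\alpha|\ge1}e_\alpha\otimes y_\alpha$. The unitaries $U_n$ ($n\ge1$) are defined by the same formulas with $\underline C,\mathcal H_C,\mathcal D_C,C_j,(D_C)_j$ replaced by $\underline E,\mathcal H_E,\mathcal D_E,E_j,(D_E)_j$. $Q_n$ is the orthogonal projection of $\widehat{\mathcal H}_C$ onto $\mathcal H_C\oplus\bigoplus_{m\le n-1}((\mathbb C^d)^{\otimes m}\otimes\mathcal D_C)$, and $P_n$ is the orthogonal projection of $\mathcal H_E\otimes\mathcal P_{[1,n]}\oplus\bigoplus_{m\ge n}((\mathbb C^d)^{\otimes m}\otimes\mathcal D_E)$ onto $\mathcal H_C\otimes\mathcal P_{[1,n]}$. The space $\mathcal H_C\otimes\mathcal P_{[1,n]}$ is regarded as a subspace both of the codomain of $\tilde U_n$ and of the codomain of $U_n$, so that the compositions make sense. A coisometry is an operator whose adjoint is an isometry. *)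

theory Defs
  imports "HOL-Analysis.Analysis"
begin

section \<open>Complex Hilbert spaces\<close>

text \<open>
  A complex inner product space is rendered as a real inner product space carrying a compatible
  complex scalar multiplication and a complex inner product whose real part is the real inner
  product; norm and topology are therefore the library's.  The complex inner product is
  conjugate linear in its first argument.
\<close>

class complex_inner = real_inner +
  fixes scaleC :: "complex \<Rightarrow> 'a \<Rightarrow> 'a"  (infixr \<open>*\<^sub>C\<close> 75)
    and cinner :: "'a \<Rightarrow> 'a \<Rightarrow> complex"
  assumes scaleC_add_right: "a *\<^sub>C (x + y) = a *\<^sub>C x + a *\<^sub>C y"
    and scaleC_add_left: "(a + b) *\<^sub>C x = a *\<^sub>C x + b *\<^sub>C x"
    and scaleC_scaleC: "a *\<^sub>C b *\<^sub>C x = (a * b) *\<^sub>C x"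
    and scaleR_eq_scaleC: "r *\<^sub>R x = complex_of_real r *\<^sub>C x"
    and cinner_commute: "cinner x y = cnj (cinner y x)"
    and cinner_add_right: "cinner x (y + z) = cinner x y + cinner x z"
    and cinner_scaleC_right: "cinner x (a *\<^sub>C y) = a * cinner x y"
    and inner_eq_Re_cinner: "inner x y = Re (cinner x y)"

class chilbert_space = complex_inner + complete_space

lemma cinner_self: "cinner x x = complex_of_real ((norm x)\<^sup>2)"
proof -
  have "Im (cinner x x) = 0"
    using cinner_commute[of x x] by (metis Reals_cnj_iff complex_is_Real_iff)
  then show ?thesis
    by (simp add: complex_eq_iff power2_norm_eq_inner inner_eq_Re_cinner)
qed

lemma cinner_scaleC_left: "cinner (a *\<^sub>C x) y = cnj a * cinner x y"
  by (metis cinner_commute cinner_scaleC_right complex_cnj_mult)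

lemma norm_scaleC: "norm (a *\<^sub>C x) = cmod a * norm x"
proof -
  have "complex_of_real ((norm (a *\<^sub>C x))\<^sup>2) = cnj a * a * complex_of_real ((norm x)\<^sup>2)"
    unfolding cinner_self[symmetric] by (simp add: cinner_scaleC_left cinner_scaleC_right)
  also have "\<dots> = complex_of_real ((cmod a * norm x)\<^sup>2)"
    by (simp add: power_mult_distrib complex_norm_square[symmetric] mult.commute[of "cnj a"]
        flip: of_real_power)
  finally have "(norm (a *\<^sub>C x))\<^sup>2 = (cmod a * norm x)\<^sup>2"
    using of_real_eq_iff by blast
  then show ?thesis by simp
qed

lemma cmod_cinner_le: "cmod (cinner x y) \<le> (norm x)\<^sup>2 + (norm y)\<^sup>2"
proof -
  have "\<bar>Re (cinner x y)\<bar> \<le> norm x * norm y"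
    unfolding inner_eq_Re_cinner[symmetric] by (rule Cauchy_Schwarz_ineq2)
  moreover have "Im (cinner x y) = inner x ((- \<i>) *\<^sub>C y)"
    by (simp add: inner_eq_Re_cinner cinner_scaleC_right)
  then have "\<bar>Im (cinner x y)\<bar> \<le> norm x * norm y"
    using Cauchy_Schwarz_ineq2[of x "(- \<i>) *\<^sub>C y"] by (simp add: norm_scaleC)
  moreover have "2 * (norm x * norm y) \<le> (norm x)\<^sup>2 + (norm y)\<^sup>2"
    using sum_squares_bound[of "norm x" "norm y"] by simp
  ultimately show ?thesis
    using cmod_le[of "cinner x y"] by linarith
qed

instantiation complex :: complex_inner
begin
definition "a *\<^sub>C (x :: complex) = a * x"
definition "cinner (x :: complex) y = cnj x * y"
instance
  by standard (auto simp: scaleC_complex_def cinner_complex_def scaleR_conv_of_real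
      inner_complex_def algebra_simps)
end

instance complex :: chilbert_space ..

instantiation prod :: (complex_inner, complex_inner) complex_inner
begin
definition "a *\<^sub>C x = (a *\<^sub>C fst x, a *\<^sub>C snd x)"
definition "cinner x y = cinner (fst x) (fst y) + cinner (snd x) (snd y)"
instance
  by standard
    (auto simp: scaleC_prod_def cinner_prod_def scaleC_add_right scaleC_add_left scaleC_scaleC
      scaleR_eq_scaleC cinner_add_right cinner_scaleC_right inner_eq_Re_cinner algebra_simps
      prod_eq_iff inner_prod_def cinner_commute[symmetric])
end

instance prod :: (chilbert_space, chilbert_space) chilbert_space ..

instantiation vec :: (complex_inner, finite) complex_inner
begin
definition "a *\<^sub>C x = (\<chi> i. a *\<^sub>C (x $ i))"
definition "cinner x y = (\<Sum>i\<in>UNIV. cinner (x $ i) (y $ i))"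
instance
  by standard
    (auto simp: scaleC_vec_def cinner_vec_def scaleC_add_right scaleC_add_left scaleC_scaleC
      scaleR_eq_scaleC cinner_add_right cinner_scaleC_right inner_eq_Re_cinner
      vec_eq_iff inner_vec_def sum.distrib sum_distrib_left cinner_commute[symmetric])
end

instance vec :: (chilbert_space, finite) chilbert_space ..


section \<open>Hilbert space valued square summable families\<close>

text \<open>
  \<open>('i, 'a) ell2\<close> is the Hilbert space direct sum of copies of \<open>'a\<close> indexed by \<open>'i\<close>.
  If \<open>\<G>\<close> is a Hilbert space with orthonormal basis \<open>(e\<^sub>i)\<close>, then \<open>\<G> \<otimes> 'a\<close> is this space, the
  vector \<open>\<Sum>\<^sub>i e\<^sub>i \<otimes> y\<^sub>i\<close> being the family \<open>(y\<^sub>i)\<close>.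
\<close>

typedef (overloaded) ('i, 'a) ell2 =
  "{f :: 'i \<Rightarrow> 'a::complex_inner. (\<lambda>i. (norm (f i))\<^sup>2) summable_on UNIV}"
  morphisms coord Abs_ell2
  by (intro exI[of _ "\<lambda>_. 0"]) simp

setup_lifting type_definition_ell2

lemma ell2_summable: "(\<lambda>i. (norm (coord x i))\<^sup>2) summable_on UNIV"
  using coord[of x] by simp

lemma ell2_cong: "(\<And>i. coord x i = coord y i) \<Longrightarrow> x = y"
  by (simp add: coord_inject[symmetric] fun_eq_iff)

lemma norm_add_square_le:
  fixes x y :: "'a::real_inner"
  shows "(norm (x + y))\<^sup>2 \<le> 2 * (norm x)\<^sup>2 + 2 * (norm y)\<^sup>2"
proof -
  have "(norm (x + y))\<^sup>2 + (norm (x - y))\<^sup>2 = 2 * (norm x)\<^sup>2 + 2 * (norm y)\<^sup>2"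
    by (simp add: power2_norm_eq_inner inner_add_left inner_diff_left inner_add_right
        inner_diff_right inner_commute)
  then show ?thesis by (smt (verit) zero_le_power2)
qed

lemma square_summable_add:
  fixes f g :: "'i \<Rightarrow> 'a::real_inner"
  assumes "(\<lambda>i. (norm (f i))\<^sup>2) summable_on A" "(\<lambda>i. (norm (g i))\<^sup>2) summable_on A"
  shows "(\<lambda>i. (norm (f i + g i))\<^sup>2) summable_on A"
proof (rule summable_on_comparison_test)
  show "(\<lambda>i. 2 * (norm (f i))\<^sup>2 + 2 * (norm (g i))\<^sup>2) summable_on A"
    using assms by (intro summable_on_add summable_on_cmult_right)
qed (auto simp: norm_add_square_le)

lemma square_summable_scaleC:
  fixes f :: "'i \<Rightarrow> 'a::complex_inner"
  assumes "(\<lambda>i. (norm (f i))\<^sup>2) summable_on A"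
  shows "(\<lambda>i. (norm (a *\<^sub>C f i))\<^sup>2) summable_on A"
  using assms by (auto simp: norm_scaleC power_mult_distrib intro!: summable_on_cmult_right)

lemma cinner_summable:
  fixes f g :: "'i \<Rightarrow> 'a::complex_inner"
  assumes "(\<lambda>i. (norm (f i))\<^sup>2) summable_on A" "(\<lambda>i. (norm (g i))\<^sup>2) summable_on A"
  shows "(\<lambda>i. cinner (f i) (g i)) summable_on A"
  by (rule Infinite_Sum.abs_summable_summable, rule Infinite_Sum.abs_summable_on_comparison_test'
      [where g = "\<lambda>i. (norm (f i))\<^sup>2 + (norm (g i))\<^sup>2"])
    (use assms in \<open>auto simp: cmod_cinner_le intro: summable_on_add\<close>)

instantiation ell2 :: (type, complex_inner) complex_inner
begin

lift_definition zero_ell2 :: "('a, 'b) ell2" is "\<lambda>_. 0" by simp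
lift_definition plus_ell2 :: "('a, 'b) ell2 \<Rightarrow> ('a, 'b) ell2 \<Rightarrow> ('a, 'b) ell2"
  is "\<lambda>f g i. f i + g i" by (rule square_summable_add)
lift_definition uminus_ell2 :: "('a, 'b) ell2 \<Rightarrow> ('a, 'b) ell2" is "\<lambda>f i. - f i" by simp
lift_definition minus_ell2 :: "('a, 'b) ell2 \<Rightarrow> ('a, 'b) ell2 \<Rightarrow> ('a, 'b) ell2"
  is "\<lambda>f g i. f i - g i"
  subgoal for f g using square_summable_add[of f UNIV "\<lambda>i. - g i"] by simp
  done
lift_definition scaleC_ell2 :: "complex \<Rightarrow> ('a, 'b) ell2 \<Rightarrow> ('a, 'b) ell2"
  is "\<lambda>a f i. a *\<^sub>C f i" by (rule square_summable_scaleC)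
definition scaleR_ell2 :: "real \<Rightarrow> ('a, 'b) ell2 \<Rightarrow> ('a, 'b) ell2"
  where "scaleR_ell2 r x = complex_of_real r *\<^sub>C x"
definition cinner_ell2 :: "('a, 'b) ell2 \<Rightarrow> ('a, 'b) ell2 \<Rightarrow> complex"
  where "cinner_ell2 x y = (\<Sum>\<^sub>\<infinity>i. cinner (coord x i) (coord y i))"
definition inner_ell2 :: "('a, 'b) ell2 \<Rightarrow> ('a, 'b) ell2 \<Rightarrow> real"
  where "inner_ell2 x y = Re (cinner x y)"
definition norm_ell2 :: "('a, 'b) ell2 \<Rightarrow> real"
  where "norm_ell2 x = sqrt (inner x x)"
definition sgn_ell2 :: "('a, 'b) ell2 \<Rightarrow> ('a, 'b) ell2"
  where "sgn_ell2 x = inverse (norm x) *\<^sub>R x"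
definition dist_ell2 :: "('a, 'b) ell2 \<Rightarrow> ('a, 'b) ell2 \<Rightarrow> real"
  where "dist_ell2 x y = norm (x - y)"
definition [code del]: "(uniformity :: (('a, 'b) ell2 \<times> ('a, 'b) ell2) filter) =
  (INF e\<in>{0 <..}. principal {(x, y). dist x y < e})"
definition [code del]: "open (U :: ('a, 'b) ell2 set) \<longleftrightarrow>
  (\<forall>x\<in>U. eventually (\<lambda>(x', y). x' = x \<longrightarrow> y \<in> U) uniformity)"

lemmas coord_simps [simp] =
  zero_ell2.rep_eq plus_ell2.rep_eq uminus_ell2.rep_eq minus_ell2.rep_eq scaleC_ell2.rep_eq

lemma coord_scaleR [simp]: "coord (r *\<^sub>R x) i = r *\<^sub>R coord x i"
  for x :: "('a, 'b) ell2"
  by (simp add: scaleR_ell2_def scaleR_eq_scaleC)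

lemma ell2_cinner_summable:
  "(\<lambda>i. cinner (coord x i) (coord y i)) summable_on UNIV" for x y :: "('a, 'b) ell2"
  by (rule cinner_summable[OF ell2_summable ell2_summable])

lemma inner_ell2_self: "inner x x = (\<Sum>\<^sub>\<infinity>i. (norm (coord x i))\<^sup>2)" for x :: "('a, 'b) ell2"
  unfolding inner_ell2_def cinner_ell2_def infsum_Re[OF ell2_cinner_summable, symmetric]
  by (simp add: cinner_self)

instance
proof
  fix x y z :: "('a, 'b) ell2" and a b :: complex and r s :: real
  show "x + y + z = x + (y + z)" by (rule ell2_cong) simp
  show "x + y = y + x" by (rule ell2_cong) simp
  show "0 + x = x" by (rule ell2_cong) simp
  show "- x + x = 0" by (rule ell2_cong) simp
  show "x - y = x + - y" by (rule ell2_cong) simp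
  show "r *\<^sub>R (x + y) = r *\<^sub>R x + r *\<^sub>R y" by (rule ell2_cong) (simp add: scaleR_right_distrib)
  show "(r + s) *\<^sub>R x = r *\<^sub>R x + s *\<^sub>R x" by (rule ell2_cong) (simp add: scaleR_left_distrib)
  show "r *\<^sub>R s *\<^sub>R x = (r * s) *\<^sub>R x" by (rule ell2_cong) simp
  show "1 *\<^sub>R x = x" by (rule ell2_cong) simp
  show "sgn x = inverse (norm x) *\<^sub>R x" by (rule sgn_ell2_def)
  show "dist x y = norm (x - y)" by (rule dist_ell2_def)
  show "uniformity = (INF e\<in>{0 <..}. principal {(x, y :: ('a, 'b) ell2). dist x y < e})"
    by (rule uniformity_ell2_def)
  show "open U \<longleftrightarrow> (\<forall>x\<in>U. eventually (\<lambda>(x', y). x' = x \<longrightarrow> y \<in> U) uniformity)"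
    for U :: "('a, 'b) ell2 set" by (rule open_ell2_def)
  show comm: "cinner x y = cnj (cinner y x)" for x y :: "('a, 'b) ell2"
    by (simp add: cinner_ell2_def infsum_cnj[symmetric] cinner_commute[symmetric] del: infsum_cnj)
  show add: "cinner x (y + z) = cinner x y + cinner x z" for x y z :: "('a, 'b) ell2"
    by (simp add: cinner_ell2_def cinner_add_right infsum_add ell2_cinner_summable)
  show scale: "cinner x (a *\<^sub>C y) = a * cinner x y" for x y :: "('a, 'b) ell2" and a
    by (simp add: cinner_ell2_def cinner_scaleC_right infsum_cmult_right')
  show "inner x y = Re (cinner x y)" by (rule inner_ell2_def)
  show ic: "inner x y = inner y x" for x y :: "('a, 'b) ell2"
    by (metis comm complex_cnj(1) inner_ell2_def cnj.simps(1))
  show "inner (x + y) z = inner x z + inner y z"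
    by (simp add: ic[of _ z]) (simp add: inner_ell2_def add)
  show "inner (r *\<^sub>R x) y = r * inner x y"
    by (simp add: ic[of _ y]) (simp add: inner_ell2_def scaleR_ell2_def scale)
  show "0 \<le> inner x x" by (simp add: inner_ell2_self infsum_nonneg)
  show "inner x x = 0 \<longleftrightarrow> x = 0"
  proof
    assume "inner x x = 0"
    then have "(norm (coord x i))\<^sup>2 = 0" for i
      using nonneg_infsum_le_0D[OF _ ell2_summable, of x i] by (simp add: inner_ell2_self)
    then show "x = 0" by (intro ell2_cong) simp
  qed (simp add: inner_ell2_self)
  show "norm x = sqrt (inner x x)" by (rule norm_ell2_def)
  show "a *\<^sub>C (x + y) = a *\<^sub>C x + a *\<^sub>C y" by (rule ell2_cong) (simp add: scaleC_add_right)
  show "(a + b) *\<^sub>C x = a *\<^sub>C x + b *\<^sub>C x" by (rule ell2_cong) (simp add: scaleC_add_left)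
  show "a *\<^sub>C b *\<^sub>C x = (a * b) *\<^sub>C x" by (rule ell2_cong) (simp add: scaleC_scaleC)
  show "r *\<^sub>R x = complex_of_real r *\<^sub>C x" by (rule scaleR_ell2_def)
qed

end

lemma norm_ell2_square: "(norm x)\<^sup>2 = (\<Sum>\<^sub>\<infinity>i. (norm (coord x i))\<^sup>2)" for x :: "('i, 'a::complex_inner) ell2"
  by (simp add: power2_norm_eq_inner inner_ell2_self)

lemma sum_norm_coord_le:
  fixes x :: "('i, 'a::complex_inner) ell2"
  assumes "finite F"
  shows "(\<Sum>i\<in>F. (norm (coord x i))\<^sup>2) \<le> (norm x)\<^sup>2"
  unfolding norm_ell2_square using assms
  by (intro finite_sum_le_infsum ell2_summable) auto

lemma norm_coord_le: "norm (coord x i) \<le> norm x" for x :: "('i, 'a::complex_inner) ell2"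
  using sum_norm_coord_le[of "{i}" x] by (simp add: abs_le_square_iff[symmetric])

instance ell2 :: (type, chilbert_space) chilbert_space
proof
  fix X :: "nat \<Rightarrow> ('a, 'b) ell2"
  assume X: "Cauchy X"
  have "Cauchy (\<lambda>n. coord (X n) i)" for i
  proof (rule metric_CauchyI)
    fix e :: real assume "0 < e"
    then obtain M where M: "\<forall>m\<ge>M. \<forall>n\<ge>M. dist (X m) (X n) < e"
      using X unfolding Cauchy_def by blast
    have "dist (coord (X m) i) (coord (X n) i) \<le> dist (X m) (X n)" for m n
      using norm_coord_le[of "X m - X n" i] by (simp add: dist_norm)
    then show "\<exists>M. \<forall>m\<ge>M. \<forall>n\<ge>M. dist (coord (X m) i) (coord (X n) i) < e"
      using M by (meson le_less_trans)
  qed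
  then have "\<exists>l. (\<lambda>n. coord (X n) i) \<longlonglongrightarrow> l" for i
    using Cauchy_convergent convergent_def by blast
  then obtain f where f: "\<And>i. (\<lambda>n. coord (X n) i) \<longlonglongrightarrow> f i" by metis
  have fin: "(\<Sum>i\<in>F. (norm (coord (X n) i - f i))\<^sup>2) \<le> e\<^sup>2"
    if "finite F" and M: "\<forall>m\<ge>M. dist (X n) (X m) \<le> e" for F n e M
  proof (rule Lim_bounded)
    show "(\<lambda>m. \<Sum>i\<in>F. (norm (coord (X n) i - coord (X m) i))\<^sup>2)
        \<longlonglongrightarrow> (\<Sum>i\<in>F. (norm (coord (X n) i - f i))\<^sup>2)"
      by (intro tendsto_intros f)
    show "\<forall>m\<ge>M. (\<Sum>i\<in>F. (norm (coord (X n) i - coord (X m) i))\<^sup>2) \<le> e\<^sup>2"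
    proof (intro allI impI)
      fix m assume "M \<le> m"
      have "(\<Sum>i\<in>F. (norm (coord (X n) i - coord (X m) i))\<^sup>2) \<le> (norm (X n - X m))\<^sup>2"
        using sum_norm_coord_le[OF \<open>finite F\<close>, of "X n - X m"] by simp
      also have "\<dots> \<le> e\<^sup>2"
        using M \<open>M \<le> m\<close> by (intro power_mono) (auto simp: dist_norm)
      finally show "(\<Sum>i\<in>F. (norm (coord (X n) i - coord (X m) i))\<^sup>2) \<le> e\<^sup>2" .
    qed
  qed
  have diff_summable: "(\<lambda>i. (norm (coord (X n) i - f i))\<^sup>2) summable_on UNIV"
    if "\<forall>m\<ge>M. dist (X n) (X m) \<le> e" for n e M
    using fin[OF _ that] by (intro nonneg_bdd_above_summable_on bdd_aboveI[of _ "e\<^sup>2"]) auto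
  obtain N where "\<forall>m\<ge>N. \<forall>n\<ge>N. dist (X m) (X n) < 1"
    using X unfolding Cauchy_def by (meson zero_less_one)
  then have "(\<lambda>i. (norm (coord (X N) i - f i))\<^sup>2) summable_on UNIV"
    by (intro diff_summable[of N]) (auto intro: less_imp_le)
  then have "(\<lambda>i. (norm (- coord (X N) i + (coord (X N) i - f i)))\<^sup>2) summable_on UNIV"
    by (intro square_summable_add) (auto simp: ell2_summable)
  then have "(\<lambda>i. (norm (f i))\<^sup>2) summable_on UNIV" by simp
  then have coord_f: "coord (Abs_ell2 f) = f" by (simp add: Abs_ell2_inverse)
  have "X \<longlonglongrightarrow> Abs_ell2 f"
  proof (rule metric_LIMSEQ_I)
    fix e :: real assume "0 < e"
    then obtain M where M: "\<forall>m\<ge>M. \<forall>n\<ge>M. dist (X m) (X n) < e / 2"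
      using X unfolding Cauchy_def by (meson half_gt_zero)
    show "\<exists>M. \<forall>n\<ge>M. dist (X n) (Abs_ell2 f) < e"
    proof (intro exI allI impI)
      fix n assume "M \<le> n"
      then have n: "\<forall>m\<ge>M. dist (X n) (X m) \<le> e / 2" using M by (auto intro: less_imp_le)
      have "(norm (X n - Abs_ell2 f))\<^sup>2 \<le> (e / 2)\<^sup>2"
        unfolding norm_ell2_square
        by (intro infsum_le_finite_sums ell2_summable)
          (simp add: coord_f fin[OF _ n])
      then have "norm (X n - Abs_ell2 f) \<le> e / 2"
        using \<open>0 < e\<close> by (simp add: abs_le_square_iff[symmetric])
      then show "dist (X n) (Abs_ell2 f) < e" using \<open>0 < e\<close> by (simp add: dist_norm)
    qed
  qed
  then show "convergent X" by (auto simp: convergent_def)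
qed


section \<open>Operators on subspaces\<close>

text \<open>
  Hilbert spaces related by inclusion are closed subspaces of a common ambient type.  An operator
  between them is a HOL function of which only the values on the domain matter.
\<close>

definition closed_csubspace :: "'a::complex_inner set \<Rightarrow> bool" where
  "closed_csubspace S \<longleftrightarrow> closed S \<and> 0 \<in> S \<and> (\<forall>x\<in>S. \<forall>y\<in>S. x + y \<in> S) \<and> (\<forall>a. \<forall>x\<in>S. a *\<^sub>C x \<in> S)"

definition bounded_op :: "'a::complex_inner set \<Rightarrow> 'b::complex_inner set \<Rightarrow> ('a \<Rightarrow> 'b) \<Rightarrow> bool" where
  "bounded_op S S' f \<longleftrightarrow>
    f ` S \<subseteq> S' \<and>
    (\<forall>x\<in>S. \<forall>y\<in>S. f (x + y) = f x + f y) \<and>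
    (\<forall>a. \<forall>x\<in>S. f (a *\<^sub>C x) = a *\<^sub>C f x) \<and>
    (\<exists>K. \<forall>x\<in>S. norm (f x) \<le> K * norm x)"

definition isometry_op :: "'a::complex_inner set \<Rightarrow> 'b::complex_inner set \<Rightarrow> ('a \<Rightarrow> 'b) \<Rightarrow> bool" where
  "isometry_op S S' f \<longleftrightarrow> bounded_op S S' f \<and> (\<forall>x\<in>S. norm (f x) = norm x)"

text \<open>
  The value at \<open>y\<close> of the adjoint of an operator with domain \<open>S\<close>.  It depends on the codomain
  only through the restriction on \<open>y\<close>: for \<open>f : S \<rightarrow> S'\<close>, the adjoint \<open>S' \<rightarrow> S\<close> is obtained by
  taking \<open>y \<in> S'\<close>.
\<close>

definition adj :: "'a::complex_inner set \<Rightarrow> ('a \<Rightarrow> 'b::complex_inner) \<Rightarrow> 'b \<Rightarrow> 'a" where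
  "adj S f y = (THE x. x \<in> S \<and> (\<forall>s\<in>S. cinner (f s) y = cinner s x))"

definition coisometry_op :: "'a::complex_inner set \<Rightarrow> 'b::complex_inner set \<Rightarrow> ('a \<Rightarrow> 'b) \<Rightarrow> bool" where
  "coisometry_op S S' f \<longleftrightarrow> bounded_op S S' f \<and> isometry_op S' S (adj S f)"

definition orth_compl :: "'a::complex_inner set \<Rightarrow> 'a set" where
  "orth_compl M = {x. \<forall>m\<in>M. cinner m x = 0}"

definition orth_proj :: "'a::complex_inner set \<Rightarrow> 'a \<Rightarrow> 'a" where
  "orth_proj M x = (THE p. p \<in> M \<and> x - p \<in> orth_compl M)"

definition positive_op :: "'a::complex_inner set \<Rightarrow> ('a \<Rightarrow> 'a) \<Rightarrow> bool" where
  "positive_op S A \<longleftrightarrow> bounded_op S S A \<and> (\<forall>x\<in>S. cinner x (A x) \<in> \<real>\<^sub>\<ge>\<^sub>0)"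

text \<open>
  The square root of a positive operator \<open>A\<close> on \<open>S\<close> is unique on \<open>S\<close>; its values outside \<open>S\<close>
  are unspecified, whence \<open>SOME\<close>.
\<close>

definition sqrt_op :: "'a::complex_inner set \<Rightarrow> ('a \<Rightarrow> 'a) \<Rightarrow> 'a \<Rightarrow> 'a" where
  "sqrt_op S A = (SOME R. positive_op S R \<and> (\<forall>x\<in>S. R (R x) = A x))"

definition sot_lim :: "'a::complex_inner set \<Rightarrow> (nat \<Rightarrow> 'a \<Rightarrow> 'b::complex_inner) \<Rightarrow> ('a \<Rightarrow> 'b) \<Rightarrow> bool" where
  "sot_lim S A L \<longleftrightarrow> (\<forall>x\<in>S. (\<lambda>n. A n x) \<longlonglongrightarrow> L x)"


section \<open>Operator tuples, defect operators and liftings\<close>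

text \<open>
  Below \<open>H\<close> is a closed subspace and \<open>T = (T\<^sub>j)\<close> a tuple of operators on \<open>H\<close>, indexed by a finite
  type \<open>'d\<close> with \<open>d\<close> elements.
\<close>

definition coisometric_tuple :: "'a::chilbert_space set \<Rightarrow> ('d::finite \<Rightarrow> 'a \<Rightarrow> 'a) \<Rightarrow> bool" where
  "coisometric_tuple H T \<longleftrightarrow>
    (\<forall>j. bounded_op H H (T j)) \<and> (\<forall>h\<in>H. (\<Sum>j\<in>UNIV. T j (adj H (T j) h)) = h)"

definition coisometric_lifting ::
    "'a::chilbert_space set \<Rightarrow> ('d::finite \<Rightarrow> 'a \<Rightarrow> 'a) \<Rightarrow> ('d \<Rightarrow> 'a \<Rightarrow> 'a) \<Rightarrow> bool" where
  "coisometric_lifting HC C E \<longleftrightarrow>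
    coisometric_tuple UNIV E \<and>
    (\<exists>B A. \<forall>j.
      bounded_op HC (orth_compl HC) (B j) \<and>
      bounded_op (orth_compl HC) (orth_compl HC) (A j) \<and>
      (\<forall>h\<in>HC. \<forall>k\<in>orth_compl HC. E j (h + k) = C j h + (B j h + A j k)))"

definition row_space :: "'a set \<Rightarrow> ('a ^ 'd::finite) set" where
  "row_space H = {x. \<forall>j. x $ j \<in> H}"

definition row_op :: "('d::finite \<Rightarrow> 'a \<Rightarrow> 'a) \<Rightarrow> 'a::complex_inner ^ 'd \<Rightarrow> 'a" where
  "row_op T x = (\<Sum>j\<in>UNIV. T j (x $ j))"

definition defect_op ::
    "'a::chilbert_space set \<Rightarrow> ('d::finite \<Rightarrow> 'a \<Rightarrow> 'a) \<Rightarrow> 'a ^ 'd \<Rightarrow> 'a ^ 'd" where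
  "defect_op H T = sqrt_op (row_space H) (\<lambda>x. x - adj (row_space H) (row_op T) (row_op T x))"

definition defect_space :: "'a::chilbert_space set \<Rightarrow> ('d::finite \<Rightarrow> 'a \<Rightarrow> 'a) \<Rightarrow> ('a ^ 'd) set" where
  "defect_space H T = closure (defect_op H T ` row_space H)"

definition defect_comp ::
    "'a::chilbert_space set \<Rightarrow> ('d::finite \<Rightarrow> 'a \<Rightarrow> 'a) \<Rightarrow> 'd \<Rightarrow> 'a \<Rightarrow> 'a ^ 'd" where
  "defect_comp H T j h = defect_op H T (axis j h)"


section \<open>The spaces and unitaries of the construction\<close>

text \<open>
  Words are lists over \<open>'d\<close>.  With respect to the orthonormal bases \<open>(e\<^sub>\<alpha>)\<close> of the full Fock space
  and \<open>(\<epsilon>\<^sub>w)\<^bsub>|w| = n\<^esub>\<close> of \<open>\<P>\<^bsub>[1,n]\<^esub>\<close>, the vectors \<open>\<Sum>\<^sub>\<alpha> e\<^sub>\<alpha> \<otimes> y\<^sub>\<alpha>\<close> and \<open>\<Sum>\<^bsub>|w| = n\<^esub> h\<^sub>w \<otimes> \<epsilon>\<^sub>w\<close> are the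
  families \<open>(y\<^sub>\<alpha>)\<close> and \<open>(h\<^sub>w)\<close>, the latter extended by \<open>0\<close> to words of other lengths.  So all spaces
  of the construction, for every \<open>n\<close> and for both tuples, lie in one ambient Hilbert space, and
  \<open>H\<^sub>C \<otimes> \<P>\<^bsub>[1,n]\<^esub>\<close> is literally contained in the codomains of both \<open>n\<close>-th unitaries.
\<close>

type_synonym ('d, 'a) ambient = "('d list, 'a) ell2 \<times> ('d list, 'a ^ 'd) ell2"

text \<open>
  \<open>HP_space H n\<close> is \<open>H \<otimes> \<P>\<^bsub>[1,n]\<^esub>\<close> and \<open>level_space H T n\<close> is
  \<open>H \<otimes> \<P>\<^bsub>[1,n]\<^esub> \<oplus> \<Oplus>\<^bsub>m \<ge> n\<^esub> (\<complex>\<^sup>d)\<^sup>\<otimes>\<^sup>m \<otimes> \<D>\<^sub>T\<close>.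
\<close>

definition HP_space :: "'a::chilbert_space set \<Rightarrow> nat \<Rightarrow> ('d::finite, 'a) ambient set" where
  "HP_space H n = {(f, y). (\<forall>w. coord f w \<in> H) \<and> (\<forall>w. length w \<noteq> n \<longrightarrow> coord f w = 0) \<and> y = 0}"

definition level_space ::
    "'a::chilbert_space set \<Rightarrow> ('d::finite \<Rightarrow> 'a \<Rightarrow> 'a) \<Rightarrow> nat \<Rightarrow> ('d, 'a) ambient set" where
  "level_space H T n = {(f, y).
    (\<forall>w. coord f w \<in> H) \<and> (\<forall>w. length w \<noteq> n \<longrightarrow> coord f w = 0) \<and>
    (\<forall>\<alpha>. coord y \<alpha> \<in> defect_space H T) \<and> (\<forall>\<alpha>. length \<alpha> < n \<longrightarrow> coord y \<alpha> = 0)}"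

text \<open>
  \<open>H \<oplus> (\<Gamma> \<otimes> \<D>\<^sub>T)\<close>, where \<open>H = H \<otimes> \<complex> = H \<otimes> \<P>\<^bsub>[1,0]\<^esub>\<close>: the vector \<open>h \<in> H\<close> is the family with value
  \<open>h\<close> at the empty word.
\<close>

definition hat_space ::
    "'a::chilbert_space set \<Rightarrow> ('d::finite \<Rightarrow> 'a \<Rightarrow> 'a) \<Rightarrow> ('d, 'a) ambient set" where
  "hat_space H T = level_space H T 0"

text \<open>
  The \<open>n\<close>-th unitary, from \<open>level_space H T (n - 1)\<close> to \<open>level_space H T n\<close>, for \<open>n \<ge> 1\<close>.  The word
  \<open>j\<^sub>1\<dots>j\<^sub>n\<close> is \<open>w\<close>, so that \<open>j\<^sub>n = last w\<close> and \<open>j\<^sub>1\<dots>j\<^sub>n\<^sub>-\<^sub>1 = butlast w\<close>.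
\<close>

definition U_op ::
    "'a::chilbert_space set \<Rightarrow> ('d::finite \<Rightarrow> 'a \<Rightarrow> 'a) \<Rightarrow> nat \<Rightarrow> ('d, 'a) ambient \<Rightarrow> ('d, 'a) ambient" where
  "U_op H T n = (\<lambda>(f, y).
    (Abs_ell2 (\<lambda>w. if length w = n
        then adj H (T (last w)) (coord f (butlast w)) +
             adj H (defect_comp H T (last w)) (coord y (butlast w))
        else 0),
     Abs_ell2 (\<lambda>\<alpha>. if n \<le> length \<alpha> then coord y \<alpha> else 0)))"

lemma coord_U_op:
  fixes T :: "'d::finite \<Rightarrow> 'a::chilbert_space \<Rightarrow> 'a"
  shows "coord (fst (U_op H T n (f, y))) w =
      (if length w = n
       then adj H (T (last w)) (coord f (butlast w)) +
            adj H (defect_comp H T (last w)) (coord y (butlast w))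
       else 0)" (is ?A)
    and "coord (snd (U_op H T n (f, y))) \<alpha> = (if n \<le> length \<alpha> then coord y \<alpha> else 0)" (is ?B)
proof -
  have "finite {w :: 'd list. length w = n}"
    using finite_lists_length_eq[of "UNIV :: 'd set" n] by simp
  then have "(\<lambda>w. (norm (if length w = n then g w else 0))\<^sup>2) summable_on UNIV"
    for g :: "'d list \<Rightarrow> 'a"
    by (subst summable_on_cong_neutral[where T = "{w. length w = n}"
          and g = "\<lambda>w. (norm (g w))\<^sup>2"]) auto
  then show ?A
    by (simp add: U_op_def Abs_ell2_inverse)
  have "(\<lambda>\<alpha>. (norm (if n \<le> length \<alpha> then coord y \<alpha> else 0))\<^sup>2) summable_on UNIV"
    by (rule summable_on_comparison_test[OF ell2_summable[of y]]) auto
  then show ?B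
    by (simp add: U_op_def Abs_ell2_inverse)
qed

primrec U_prod ::
    "'a::chilbert_space set \<Rightarrow> ('d::finite \<Rightarrow> 'a \<Rightarrow> 'a) \<Rightarrow> nat \<Rightarrow> ('d, 'a) ambient \<Rightarrow> ('d, 'a) ambient" where
  "U_prod H T 0 = id"
| "U_prod H T (Suc n) = U_op H T (Suc n) \<circ> U_prod H T n"

primrec U_adj_prod ::
    "'a::chilbert_space set \<Rightarrow> ('d::finite \<Rightarrow> 'a \<Rightarrow> 'a) \<Rightarrow> nat \<Rightarrow> ('d, 'a) ambient \<Rightarrow> ('d, 'a) ambient" where
  "U_adj_prod H T 0 = id"
| "U_adj_prod H T (Suc n) = U_adj_prod H T n \<circ> adj (level_space H T n) (U_op H T (Suc n))"

definition P_proj :: "'a::chilbert_space set \<Rightarrow> nat \<Rightarrow> ('d::finite, 'a) ambient \<Rightarrow> ('d, 'a) ambient" where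
  "P_proj HC n = orth_proj (HP_space HC n)"

definition Q_proj ::
    "'a::chilbert_space set \<Rightarrow> ('d::finite \<Rightarrow> 'a \<Rightarrow> 'a) \<Rightarrow> nat \<Rightarrow> ('d, 'a) ambient \<Rightarrow> ('d, 'a) ambient" where
  "Q_proj HC C n =
    orth_proj {(f, y) \<in> hat_space HC C. \<forall>\<alpha>. n \<le> length \<alpha> \<longrightarrow> coord y \<alpha> = 0}"

end

theory Submission
  imports Defs
begin

text \<open>
  Let \<open>U\<^sub>n\<close> and \<open>U'\<^sub>n\<close> be the \<open>n\<close>-th unitaries for \<open>E\<close> and \<open>C\<close>, and write
  \<open>W\<^sub>n = U'\<^sub>1\<^sup>* \<cdots> U'\<^sub>n\<^sup>* P\<^sub>n U\<^sub>n \<cdots> U\<^sub>1\<close> and \<open>V\<^sub>n = U\<^sub>1\<^sup>* \<cdots> U\<^sub>n\<^sup>* U'\<^sub>n \<cdots> U'\<^sub>1 Q\<^sub>n\<close>.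

  The operators \<open>V\<^sub>n\<close> are easy to control.  The product \<open>U'\<^sub>n \<cdots> U'\<^sub>1\<close> maps the range of \<open>Q\<^sub>n\<close> into
  \<open>H\<^sub>C \<otimes> \<P>\<^bsub>[1,n]\<^esub>\<close>, and because \<open>E\<^sub>j\<^sup>*\<close> extends \<open>C\<^sub>j\<^sup>*\<close> the next step \<open>U'\<^sub>n\<^sub>+\<^sub>1\<close> agrees there with \<open>U\<^sub>n\<^sub>+\<^sub>1\<close>
  (\<open>U_op_lifting\<close>).  Hence \<open>V\<^sub>m Q\<^sub>n = V\<^sub>n\<close> for \<open>m \<ge> n\<close> (\<open>V_Q_proj\<close>).  Moreover \<open>\<parallel>V\<^sub>n x\<parallel> = \<parallel>Q\<^sub>n x\<parallel>\<close> by
  unitarity, and \<open>Q\<^sub>n \<rightarrow> I\<close> strongly.  These facts alone imply that \<open>V\<^sub>n\<close> converges strongly to an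
  isometry \<open>L\<close> with \<open>L Q\<^sub>n = V\<^sub>n\<close> (\<open>isometry_op_limit\<close>).

  The strong convergence of \<open>W\<^sub>n\<close> follows by taking adjoints.  Since \<open>W\<^sub>n\<close> is the adjoint of \<open>V\<^sub>n\<close>
  (\<open>cinner_V\<close>), \<open>L Q\<^sub>n = V\<^sub>n\<close> becomes \<open>W\<^sub>n = Q\<^sub>n L\<^sup>*\<close>, which converges strongly to \<open>L\<^sup>*\<close>.  So the limit
  is the coisometry \<open>L\<^sup>*\<close>, with adjoint \<open>L\<close>.

  The unitarity of the steps rests on the structure of the defect operator: for a coisometric tuple
  it is the orthogonal projection onto the kernel of the row operator \<open>T\<close> (\<open>defect_op_eq\<close>), so that
  \<open>(h, y) \<mapsto> T\<^sup>* h + y\<close> is unitary from \<open>H \<oplus> \<D>\<^sub>T\<close> to \<open>H\<^sup>d\<close>, and the \<open>n\<close>-th step is a direct sum of copies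
  of this map and an identity.
\<close>

section \<open>Projections and adjoints in complex Hilbert spaces\<close>

lemma cinner_add_left: "cinner (x + y) z = cinner x z + cinner y z"
  by (metis cinner_add_right cinner_commute complex_cnj_add)

lemma scaleC_minus_one [simp]: "(-1) *\<^sub>C x = - x"
  using scaleR_eq_scaleC[of "-1" x] by simp

lemma scaleC_zero_left [simp]: "0 *\<^sub>C x = 0"
  using scaleR_eq_scaleC[of 0 x] by simp

lemma scaleC_zero_right [simp]: "a *\<^sub>C 0 = 0"
  using scaleC_add_right[of a 0 0] by simp

lemma cinner_zero_right [simp]: "cinner x 0 = 0"
  using cinner_add_right[of x 0 0] by simp

lemma cinner_zero_left [simp]: "cinner 0 x = 0"
  using cinner_add_left[of 0 0 x] by simp

lemma cinner_minus_right [simp]: "cinner x (- y) = - cinner x y"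
  using cinner_scaleC_right[of x "-1" y] by simp

lemma cinner_minus_left [simp]: "cinner (- x) y = - cinner x y"
  using cinner_scaleC_left[of "-1" x y] by simp

lemma cinner_diff_right: "cinner x (y - z) = cinner x y - cinner x z"
  using cinner_add_right[of x y "- z"] by simp

lemma cinner_diff_left: "cinner (x - y) z = cinner x z - cinner y z"
  using cinner_add_left[of x "- y" z] by simp

lemma cinner_sum_left: "cinner (\<Sum>i\<in>I. f i) y = (\<Sum>i\<in>I. cinner (f i) y)"
  by (induction I rule: infinite_finite_induct) (auto simp: cinner_add_left)

lemma cinner_eq_zero_commute: "cinner x y = 0 \<longleftrightarrow> cinner y x = 0"
  by (metis cinner_commute complex_cnj_zero)

lemma cinner_self_eq_zero [simp]: "cinner x x = 0 \<longleftrightarrow> x = 0"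
  by (simp add: cinner_self)

lemma cinner_eq_inner: "cinner x y = Complex (inner x y) (inner (\<i> *\<^sub>C x) y)"
  by (simp add: complex_eq_iff inner_eq_Re_cinner cinner_scaleC_left)

lemma bounded_linear_cinner_right: "bounded_linear (cinner x)"
proof (rule bounded_linear_intro[where K = "2 * norm x"])
  fix y
  have "\<bar>Re (cinner x y)\<bar> \<le> norm x * norm y" "\<bar>Im (cinner x y)\<bar> \<le> norm x * norm y"
    using Cauchy_Schwarz_ineq2[of x y] Cauchy_Schwarz_ineq2[of "\<i> *\<^sub>C x" y]
    by (simp_all add: cinner_eq_inner norm_scaleC)
  then show "norm (cinner x y) \<le> norm y * (2 * norm x)"
    using cmod_le[of "cinner x y"] by (simp add: algebra_simps)
qed (simp_all add: cinner_add_right scaleR_eq_scaleC cinner_scaleC_right scaleC_complex_def)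

lemma closed_csubspaceD:
  assumes "closed_csubspace S"
  shows "closed S" "0 \<in> S" "x \<in> S \<Longrightarrow> y \<in> S \<Longrightarrow> x + y \<in> S" "x \<in> S \<Longrightarrow> a *\<^sub>C x \<in> S"
    "x \<in> S \<Longrightarrow> - x \<in> S" "x \<in> S \<Longrightarrow> y \<in> S \<Longrightarrow> x - y \<in> S" "x \<in> S \<Longrightarrow> r *\<^sub>R x \<in> S"
proof -
  show 1: "closed S" "0 \<in> S" "x \<in> S \<Longrightarrow> y \<in> S \<Longrightarrow> x + y \<in> S" and 2: "x \<in> S \<Longrightarrow> a *\<^sub>C x \<in> S" for x y a
    using assms by (auto simp: closed_csubspace_def)
  show m: "x \<in> S \<Longrightarrow> - x \<in> S" for x
    using 2[of x "-1"] by simp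
  show "x \<in> S \<Longrightarrow> y \<in> S \<Longrightarrow> x - y \<in> S"
    using 1(3)[of x "- y"] m by simp
  show "x \<in> S \<Longrightarrow> r *\<^sub>R x \<in> S"
    using 2 by (simp add: scaleR_eq_scaleC)
qed

lemma closed_csubspace_UNIV: "closed_csubspace UNIV"
  by (simp add: closed_csubspace_def)

lemma orth_compl_eq:
  "orth_compl M = (\<Inter>m\<in>M. {x. cinner m x = 0})"
  by (auto simp: orth_compl_def)

lemma closed_csubspace_orth_compl: "closed_csubspace (orth_compl M)"
proof -
  have "closed {x. cinner m x = 0}" for m :: 'a
    by (intro closed_Collect_eq continuous_intros
        bounded_linear.continuous_on[OF bounded_linear_cinner_right])
  then show ?thesis
    unfolding closed_csubspace_def orth_compl_eq
    by (auto simp: cinner_add_right cinner_scaleC_right)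
qed

lemma bounded_opD:
  assumes "bounded_op S S' f"
  shows "x \<in> S \<Longrightarrow> f x \<in> S'" "x \<in> S \<Longrightarrow> y \<in> S \<Longrightarrow> f (x + y) = f x + f y"
    "x \<in> S \<Longrightarrow> f (a *\<^sub>C x) = a *\<^sub>C f x" "\<exists>K\<ge>0. \<forall>x\<in>S. norm (f x) \<le> K * norm x"
    "x \<in> S \<Longrightarrow> f (- x) = - f x"
proof -
  show 1: "x \<in> S \<Longrightarrow> f x \<in> S'" "x \<in> S \<Longrightarrow> y \<in> S \<Longrightarrow> f (x + y) = f x + f y"
     and s: "x \<in> S \<Longrightarrow> f (a *\<^sub>C x) = a *\<^sub>C f x" for x y a
    using assms by (auto simp: bounded_op_def)
  obtain K where K: "\<forall>x\<in>S. norm (f x) \<le> K * norm x"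
    using assms by (auto simp: bounded_op_def)
  have "norm (f x) \<le> \<bar>K\<bar> * norm x" if "x \<in> S" for x
    using K that by (meson abs_ge_self mult_right_mono norm_ge_zero order_trans)
  then show "\<exists>K\<ge>0. \<forall>x\<in>S. norm (f x) \<le> K * norm x"
    by (intro exI[of _ "\<bar>K\<bar>"]) auto
  show "x \<in> S \<Longrightarrow> f (- x) = - f x"
    using s[of x "-1"] by simp
qed

lemma bounded_op_diff:
  assumes "closed_csubspace S" "bounded_op S S' f" "x \<in> S" "y \<in> S"
  shows "f (x - y) = f x - f y"
  using bounded_opD(2)[OF assms(2,3), of "- y"] bounded_opD(5)[OF assms(2,4)]
    closed_csubspaceD(5)[OF assms(1,4)] by simp

lemma continuous_on_bounded_op:
  assumes S: "closed_csubspace S" and f: "bounded_op S S' f"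
  shows "continuous_on S f"
proof -
  obtain K where K: "K \<ge> 0" "\<forall>x\<in>S. norm (f x) \<le> K * norm x"
    using bounded_opD(4)[OF f] by blast
  have "K-lipschitz_on S f"
  proof (rule lipschitz_onI)
    fix x y assume "x \<in> S" "y \<in> S"
    then show "dist (f x) (f y) \<le> K * dist x y"
      using K(2) closed_csubspaceD(6)[OF S] by (simp add: dist_norm bounded_op_diff[OF S f, symmetric])
  qed (rule K)
  then show ?thesis by (rule lipschitz_on_continuous_on)
qed

text \<open>
  By the parallelogram law a sequence in \<open>S\<close> whose distance to \<open>x\<close> tends to the infimum is
  Cauchy; the first variation at its limit \<open>p\<close> shows that \<open>x - p\<close> is orthogonal to \<open>S\<close>.
\<close>

lemma orth_decomposition:
  fixes S :: "'a::chilbert_space set"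
  assumes S: "closed_csubspace S"
  shows "\<exists>p\<in>S. x - p \<in> orth_compl S"
proof -
  note SD = closed_csubspaceD[OF S]
  define \<delta> where "\<delta> = (INF s\<in>S. (norm (x - s))\<^sup>2)"
  have bdd: "bdd_below ((\<lambda>s. (norm (x - s))\<^sup>2) ` S)"
    by (intro bdd_belowI[of _ 0]) auto
  have \<delta>: "\<delta> \<le> (norm (x - s))\<^sup>2" if "s \<in> S" for s
    unfolding \<delta>_def by (rule cINF_lower[OF bdd that])
  have "\<exists>s\<in>S. (norm (x - s))\<^sup>2 < \<delta> + inverse (Suc n)" for n
    using cINF_less_iff[OF _ bdd, of "\<delta> + inverse (Suc n)"] SD(2) unfolding \<delta>_def by auto
  then obtain s where s: "\<And>n. s n \<in> S" "\<And>n. (norm (x - s n))\<^sup>2 < \<delta> + inverse (Suc n)"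
    by metis
  have par: "(norm (s m - s n))\<^sup>2 \<le> 2 * inverse (Suc m) + 2 * inverse (Suc n)" for m n
  proof -
    have "(1 / 2) *\<^sub>R (s m + s n) \<in> S" using s(1) SD by auto
    from \<delta>[OF this] have "\<delta> \<le> (norm (x - (1 / 2) *\<^sub>R (s m + s n)))\<^sup>2" .
    moreover have "(norm (s m - s n))\<^sup>2 + 4 * (norm (x - (1 / 2) *\<^sub>R (s m + s n)))\<^sup>2
        = 2 * (norm (x - s m))\<^sup>2 + 2 * (norm (x - s n))\<^sup>2"
      by (simp add: power2_norm_eq_inner inner_add_left inner_diff_left inner_add_right
        inner_diff_right inner_commute algebra_simps)
    ultimately show ?thesis using s(2)[of m] s(2)[of n] by linarith
  qed
  have "Cauchy s"
  proof (rule metric_CauchyI)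
    fix e :: real assume "0 < e"
    then obtain M where M: "inverse (Suc M) < e\<^sup>2 / 4"
      using reals_Archimedean[of "e\<^sup>2 / 4"] by auto
    have "dist (s m) (s n) < e" if "M \<le> m" "M \<le> n" for m n
    proof -
      have "inverse (Suc m) \<le> inverse (Suc M)" "inverse (Suc n) \<le> inverse (Suc M)"
        using that by (simp_all add: le_imp_inverse_le)
      then have "(norm (s m - s n))\<^sup>2 < e\<^sup>2"
        using par[of m n] M by linarith
      then show ?thesis using \<open>0 < e\<close> by (simp add: dist_norm power_less_imp_less_base)
    qed
    then show "\<exists>M. \<forall>m\<ge>M. \<forall>n\<ge>M. dist (s m) (s n) < e" by blast
  qed
  then obtain p where p: "s \<longlonglongrightarrow> p"
    using Cauchy_convergent convergent_def by blast
  have "p \<in> S" using closed_sequentially[OF SD(1) _ p] s(1) by blast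
  have min: "(norm (x - p))\<^sup>2 \<le> \<delta>"
  proof (rule LIMSEQ_le)
    show "(\<lambda>n. (norm (x - s n))\<^sup>2) \<longlonglongrightarrow> (norm (x - p))\<^sup>2" by (intro tendsto_intros p)
    show "(\<lambda>n. \<delta> + inverse (Suc n)) \<longlonglongrightarrow> \<delta>"
      using tendsto_add[OF tendsto_const LIMSEQ_inverse_real_of_nat, of \<delta>] by simp
    show "\<exists>N. \<forall>n\<ge>N. (norm (x - s n))\<^sup>2 \<le> \<delta> + inverse (Suc n)"
      using s(2) less_imp_le by blast
  qed
  have expand: "(norm (z - t *\<^sub>R m))\<^sup>2 = (norm z)\<^sup>2 - 2 * t * inner z m + t\<^sup>2 * (norm m)\<^sup>2"
    for z m :: 'a and t
    by (simp only: power2_norm_eq_inner inner_diff_left inner_diff_right inner_scaleR_left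
        inner_scaleR_right) (simp add: inner_commute algebra_simps power2_eq_square)
  have "inner (x - p) m = 0" if "m \<in> S" for m
  proof (cases "m = 0")
    case False
    \<comment> \<open>The minimizer of \<open>\<parallel>x - p - t m\<parallel>\<close>.\<close>
    define t where "t = inner (x - p) m / (norm m)\<^sup>2"
    have "p + t *\<^sub>R m \<in> S" using \<open>p \<in> S\<close> that SD by auto
    then have "(norm (x - p))\<^sup>2 \<le> (norm ((x - p) - t *\<^sub>R m))\<^sup>2"
      unfolding diff_diff_eq by (rule order_trans[OF min \<delta>])
    also have "\<dots> = (norm (x - p))\<^sup>2 - 2 * t * inner (x - p) m + t\<^sup>2 * (norm m)\<^sup>2"
      by (rule expand)
    also have "\<dots> = (norm (x - p))\<^sup>2 - (inner (x - p) m)\<^sup>2 / (norm m)\<^sup>2"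
      using False unfolding t_def by (simp add: power2_eq_square field_simps)
    finally have "(inner (x - p) m)\<^sup>2 / (norm m)\<^sup>2 \<le> 0" by simp
    then show ?thesis using False by (simp add: divide_le_0_iff)
  qed simp
  then have "cinner m (x - p) = 0" if "m \<in> S" for m
    using that SD(4) by (simp add: cinner_eq_inner inner_commute complex_eq_iff)
  then show ?thesis using \<open>p \<in> S\<close> by (auto simp: orth_compl_def)
qed

lemma orth_proj_eqI:
  assumes "closed_csubspace M" "p \<in> M" "x - p \<in> orth_compl M"
  shows "orth_proj M x = p"
  unfolding orth_proj_def
proof (rule the_equality)
  fix q assume q: "q \<in> M \<and> x - q \<in> orth_compl M"
  then have "q - p \<in> M" using assms closed_csubspaceD by blast
  moreover have "(x - p) - (x - q) \<in> orth_compl M"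
    using closed_csubspaceD(6)[OF closed_csubspace_orth_compl] assms(3) q by blast
  ultimately have "cinner (q - p) (q - p) = 0" by (simp add: orth_compl_def)
  then show "q = p" by simp
qed (use assms in blast)

lemma orth_proj:
  fixes M :: "'a::chilbert_space set"
  assumes "closed_csubspace M"
  shows "orth_proj M x \<in> M" "x - orth_proj M x \<in> orth_compl M"
  using orth_decomposition[OF assms, of x] orth_proj_eqI[OF assms] by auto

lemma cinner_orth_proj_left:
  fixes M :: "'a::chilbert_space set"
  assumes "closed_csubspace M" "m \<in> M"
  shows "cinner (orth_proj M x) m = cinner x m"
proof -
  have "cinner m (x - orth_proj M x) = 0"
    using orth_proj(2)[OF assms(1)] assms(2) by (auto simp: orth_compl_def)
  then have "cinner (x - orth_proj M x) m = 0" by (simp add: cinner_eq_zero_commute)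
  then show ?thesis by (simp add: cinner_diff_left)
qed

lemma cinner_orth_proj_right:
  fixes M :: "'a::chilbert_space set"
  assumes "closed_csubspace M" "m \<in> M"
  shows "cinner m (orth_proj M x) = cinner m x"
  using cinner_orth_proj_left[OF assms, of x] by (metis cinner_commute)

lemma norm_orth_proj_le:
  fixes M :: "'a::chilbert_space set"
  assumes M: "closed_csubspace M"
  shows "norm (orth_proj M x) \<le> norm x"
proof (cases "orth_proj M x = 0")
  case False
  have "(norm (orth_proj M x))\<^sup>2 = inner x (orth_proj M x)"
    using cinner_orth_proj_left[OF M orth_proj(1)[OF M], of x x]
    by (metis inner_eq_Re_cinner power2_norm_eq_inner)
  also have "\<dots> \<le> norm x * norm (orth_proj M x)" by (rule norm_cauchy_schwarz)
  finally show ?thesis using False by (simp add: power2_eq_square)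
qed simp

lemma bounded_orth_proj:
  fixes M :: "'a::chilbert_space set"
  assumes M: "closed_csubspace M"
  shows "bounded_op UNIV M (orth_proj M)"
proof -
  note MD = closed_csubspaceD[OF M] and OD = closed_csubspaceD[OF closed_csubspace_orth_compl[of M]]
  have "orth_proj M (x + y) = orth_proj M x + orth_proj M y" for x y
    using OD(3)[OF orth_proj(2)[OF M, of x] orth_proj(2)[OF M, of y]]
    by (intro orth_proj_eqI[OF M MD(3)] orth_proj(1)[OF M]) (simp add: algebra_simps)
  moreover have "orth_proj M (a *\<^sub>C x) = a *\<^sub>C orth_proj M x" for a x
  proof (intro orth_proj_eqI[OF M MD(4)] orth_proj(1)[OF M])
    have "a *\<^sub>C (x - orth_proj M x) + a *\<^sub>C orth_proj M x = a *\<^sub>C x"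
      by (simp flip: scaleC_add_right)
    then have "a *\<^sub>C x - a *\<^sub>C orth_proj M x = a *\<^sub>C (x - orth_proj M x)"
      by (simp add: algebra_simps)
    then show "a *\<^sub>C x - a *\<^sub>C orth_proj M x \<in> orth_compl M"
      using OD(4)[OF orth_proj(2)[OF M, of x], of a] by simp
  qed
  ultimately show ?thesis
    using orth_proj(1)[OF M] norm_orth_proj_le[OF M]
    by (auto simp: bounded_op_def intro!: exI[of _ 1])
qed

lemma cinner_right_eqI:
  assumes "closed_csubspace S" "x \<in> S" "y \<in> S" "\<And>s. s \<in> S \<Longrightarrow> cinner s x = cinner s y"
  shows "x = y"
proof -
  have "cinner (x - y) (x - y) = 0"
    using assms(4)[of "x - y"] closed_csubspaceD(6)[OF assms(1-3)] by (simp add: cinner_diff_right)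
  then show ?thesis by simp
qed

lemma adj_eqI:
  assumes "closed_csubspace S" "x \<in> S" "\<And>s. s \<in> S \<Longrightarrow> cinner (f s) y = cinner s x"
  shows "adj S f y = x"
  unfolding adj_def
  by (rule the_equality) (use assms cinner_right_eqI[OF assms(1)] in auto)

text \<open>
  The Riesz representation of the functional \<open>s \<mapsto> \<langle>y, f s\<rangle>\<close>: if it does not vanish, it is a multiple
  of the inner product with any nonzero vector of \<open>S\<close> orthogonal to its kernel.
\<close>

lemma adj:
  fixes S :: "'a::chilbert_space set"
  assumes S: "closed_csubspace S" and f: "bounded_op S S' f"
  shows "adj S f y \<in> S" "s \<in> S \<Longrightarrow> cinner (f s) y = cinner s (adj S f y)"
proof -
  note SD = closed_csubspaceD[OF S]
  define \<phi> where "\<phi> = (\<lambda>s. cinner y (f s))"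
  have add: "\<phi> (s + t) = \<phi> s + \<phi> t" if "s \<in> S" "t \<in> S" for s t
    using that by (simp add: \<phi>_def bounded_opD(2)[OF f] cinner_add_right)
  have scale: "\<phi> (a *\<^sub>C s) = a * \<phi> s" if "s \<in> S" for s a
    using that by (simp add: \<phi>_def bounded_opD(3)[OF f] cinner_scaleC_right)
  have "\<exists>x\<in>S. \<forall>s\<in>S. \<phi> s = cinner x s"
  proof (cases "\<forall>s\<in>S. \<phi> s = 0")
    case True
    then show ?thesis using SD(2) by (intro bexI[of _ 0]) auto
  next
    case False
    then obtain u where u: "u \<in> S" "\<phi> u \<noteq> 0" by blast
    define K where "K = {s \<in> S. \<phi> s = 0}"
    have "continuous_on S \<phi>"
      unfolding \<phi>_def by (rule bounded_linear.continuous_on[OF bounded_linear_cinner_right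
          continuous_on_bounded_op[OF S f]])
    then have "closed (S \<inter> \<phi> -` {0})"
      using SD(1) by (intro continuous_closed_preimage) auto
    moreover have "S \<inter> \<phi> -` {0} = K" by (auto simp: K_def)
    ultimately have K: "closed_csubspace K"
      using SD add scale scale[of 0 0] by (auto simp: closed_csubspace_def K_def)
    define v where "v = u - orth_proj K u"
    have p: "orth_proj K u \<in> S" "\<phi> (orth_proj K u) = 0"
      using orth_proj(1)[OF K, of u] by (auto simp: K_def)
    then have v: "v \<in> S" using u SD by (auto simp: v_def)
    have "u = v + orth_proj K u" by (simp add: v_def)
    then have "\<phi> v = \<phi> u" using add[OF v p(1)] p(2) by simp
    then have nz: "\<phi> v \<noteq> 0" using u by simp
    then have "v \<noteq> 0" using scale[of 0 0] SD(2) by auto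
    have "\<phi> s = cinner ((cnj (\<phi> v) / cinner v v) *\<^sub>C v) s" if "s \<in> S" for s
    proof -
      define k where "k = s + (- (\<phi> s / \<phi> v)) *\<^sub>C v"
      have "k \<in> K" using that v nz SD scale add by (auto simp: K_def k_def)
      then have "cinner k v = 0" using orth_proj(2)[OF K, of u] by (auto simp: v_def orth_compl_def)
      then have "cinner v k = 0" by (simp add: cinner_eq_zero_commute)
      then have "cinner v s = (\<phi> s / \<phi> v) * cinner v v"
        by (simp only: k_def cinner_add_right cinner_scaleC_right) simp
      then show ?thesis using nz \<open>v \<noteq> 0\<close>
        by (simp add: cinner_scaleC_left cinner_commute[of v v, symmetric])
    qed
    then show ?thesis using v SD(4) by blast
  qed
  then obtain x where x: "x \<in> S" "\<And>s. s \<in> S \<Longrightarrow> cinner y (f s) = cinner x s"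
    unfolding \<phi>_def by blast
  then have *: "\<And>s. s \<in> S \<Longrightarrow> cinner (f s) y = cinner s x"
    by (metis cinner_commute)
  have "adj S f y = x" by (rule adj_eqI[OF S x(1) *])
  then show "adj S f y \<in> S" "s \<in> S \<Longrightarrow> cinner (f s) y = cinner s (adj S f y)"
    using x * by auto
qed

lemma adj_add:
  fixes S :: "'a::chilbert_space set"
  assumes S: "closed_csubspace S" and f: "bounded_op S S' f"
  shows "adj S f (y + z) = adj S f y + adj S f z"
  by (rule adj_eqI[OF S])
    (auto simp: adj[OF S f] cinner_add_right intro: closed_csubspaceD(3)[OF S])

lemma adj_scaleC:
  fixes S :: "'a::chilbert_space set"
  assumes S: "closed_csubspace S" and f: "bounded_op S S' f"
  shows "adj S f (a *\<^sub>C y) = a *\<^sub>C adj S f y"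
  by (rule adj_eqI[OF S])
    (auto simp: adj[OF S f] cinner_scaleC_right intro: closed_csubspaceD(4)[OF S])

lemma adj_bounded_op:
  fixes S :: "'a::chilbert_space set"
  assumes S: "closed_csubspace S" and f: "bounded_op S S' f"
  shows "bounded_op S' S (adj S f)"
proof -
  obtain K where K: "K \<ge> 0" "\<forall>x\<in>S. norm (f x) \<le> K * norm x"
    using bounded_opD(4)[OF f] by blast
  have "norm (adj S f y) \<le> K * norm y" for y
  proof (cases "adj S f y = 0")
    case False
    have "(norm (adj S f y))\<^sup>2 = inner (f (adj S f y)) y"
      by (simp add: inner_eq_Re_cinner adj[OF S f] cinner_self)
    also have "\<dots> \<le> norm (f (adj S f y)) * norm y" by (rule norm_cauchy_schwarz)
    also have "\<dots> \<le> (K * norm (adj S f y)) * norm y"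
      using K(2) adj(1)[OF S f] by (intro mult_right_mono) auto
    finally show ?thesis using False by (simp add: power2_eq_square algebra_simps)
  qed (simp add: K(1))
  then show ?thesis
    unfolding bounded_op_def using adj[OF S f] adj_add[OF S f] adj_scaleC[OF S f] by auto
qed

text \<open>
  Polarization: norms of sums determine the real inner products, and applying this to \<open>\<i> x\<close>
  recovers the imaginary parts.
\<close>

lemma isometry_op_cinner:
  assumes S: "closed_csubspace S" and f: "isometry_op S S' f" and x: "x \<in> S" and y: "y \<in> S"
  shows "cinner (f x) (f y) = cinner x y"
proof -
  have b: "bounded_op S S' f" and n: "\<And>x. x \<in> S \<Longrightarrow> norm (f x) = norm x"
    using f by (auto simp: isometry_op_def)
  have inn: "inner u v = ((norm (u + v))\<^sup>2 - (norm u)\<^sup>2 - (norm v)\<^sup>2) / 2" for u v :: "'c::real_inner"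
    by (simp add: power2_norm_eq_inner inner_add_left inner_add_right inner_commute)
  have *: "inner (f u) (f v) = inner u v" if "u \<in> S" "v \<in> S" for u v
    unfolding inn using that n closed_csubspaceD(3)[OF S] bounded_opD(2)[OF b, symmetric] by simp
  show ?thesis
    using *[OF x y] *[OF closed_csubspaceD(4)[OF S x] y, of \<i>]
    by (simp add: cinner_eq_inner bounded_opD(3)[OF b x])
qed

definition unitary_op :: "'a::complex_inner set \<Rightarrow> 'b::complex_inner set \<Rightarrow> ('a \<Rightarrow> 'b) \<Rightarrow> bool" where
  "unitary_op S S' f \<longleftrightarrow> isometry_op S S' f \<and> f ` S = S'"

lemma unitary_op_adj:
  assumes S: "closed_csubspace S" and f: "unitary_op S S' f" and x: "x \<in> S"
  shows "adj S f (f x) = x"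
  using f by (intro adj_eqI[OF S x] isometry_op_cinner[OF S _ _ x]) (auto simp: unitary_op_def)

lemma bounded_op_comp:
  assumes "bounded_op S S' f" "bounded_op S' S'' g"
  shows "bounded_op S S'' (g \<circ> f)"
proof -
  obtain K where K: "K \<ge> 0" "\<forall>x\<in>S. norm (f x) \<le> K * norm x"
    using bounded_opD(4)[OF assms(1)] by blast
  obtain L where L: "L \<ge> 0" "\<forall>x\<in>S'. norm (g x) \<le> L * norm x"
    using bounded_opD(4)[OF assms(2)] by blast
  have "norm (g (f x)) \<le> (L * K) * norm x" if "x \<in> S" for x
  proof -
    have "norm (g (f x)) \<le> L * norm (f x)" using L that bounded_opD(1)[OF assms(1)] by blast
    also have "\<dots> \<le> L * (K * norm x)" using K L that by (intro mult_left_mono) auto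
    finally show ?thesis by (simp add: mult.assoc)
  qed
  then show ?thesis
    unfolding bounded_op_def
    using bounded_opD(1-3)[OF assms(1)] bounded_opD(1-3)[OF assms(2)] by auto
qed

lemma bounded_op_restrict:
  assumes "bounded_op S S' f" "R \<subseteq> S" "f ` R \<subseteq> R'"
  shows "bounded_op R R' f"
  using assms unfolding bounded_op_def by (meson subsetD)

lemma unitary_op_comp:
  assumes "unitary_op S S' f" "unitary_op S' S'' g"
  shows "unitary_op S S'' (g \<circ> f)"
  using assms bounded_op_comp[of S S' f S'' g]
  by (auto simp: unitary_op_def isometry_op_def bounded_opD(1) image_comp[symmetric])


section \<open>The defect operator of a coisometric tuple\<close>

text \<open>
  Over the complex numbers self-adjointness comes for free: the quadratic form \<open>\<langle>x, R x\<rangle>\<close> is real,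
  and polarizing its imaginary part along \<open>x + y\<close> and \<open>x + \<i> y\<close> gives the two parts of the claim.
\<close>

lemma positive_op_self_adjoint:
  assumes S: "closed_csubspace S" and R: "positive_op S R" and x: "x \<in> S" and y: "y \<in> S"
  shows "cinner (R x) y = cinner x (R y)"
proof -
  have b: "bounded_op S S R" and real: "\<And>x. x \<in> S \<Longrightarrow> Im (cinner x (R x)) = 0"
    using R by (auto simp: positive_op_def complex_nonneg_Reals_iff)
  have 1: "Im (cinner u (R v)) + Im (cinner v (R u)) = 0" if "u \<in> S" "v \<in> S" for u v
    using real[of "u + v"] real[of u] real[of v] that closed_csubspaceD(3)[OF S that]
    by (simp add: bounded_opD(2)[OF b] cinner_add_left cinner_add_right)
  have i: "\<i> *\<^sub>C y \<in> S" using y closed_csubspaceD(4)[OF S] by blast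
  have "Im (cinner x (R y)) = - Im (cinner y (R x))" using 1[OF x y] by simp
  moreover have "Re (cinner x (R y)) = Re (cinner y (R x))"
    using 1[OF x i] y by (simp add: bounded_opD(3)[OF b] cinner_scaleC_left cinner_scaleC_right)
  moreover have "cinner (R x) y = cnj (cinner y (R x))" by (rule cinner_commute)
  ultimately show ?thesis by (simp add: complex_eq_iff)
qed

text \<open>
  A positive square root \<open>R\<close> of a projection \<open>P\<close> satisfies \<open>\<parallel>R z\<parallel> = \<parallel>P z\<parallel>\<close>, so it vanishes on the
  kernel of \<open>P\<close>; on the range it has square one, so \<open>R x - x\<close> belongs to the eigenvalue \<open>-1\<close>,
  which positivity excludes.
\<close>

lemma sqrt_op_projection:
  assumes S: "closed_csubspace S" and P: "bounded_op S S P"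
    and idem: "\<And>x. x \<in> S \<Longrightarrow> P (P x) = P x"
    and sa: "\<And>x y. x \<in> S \<Longrightarrow> y \<in> S \<Longrightarrow> cinner (P x) y = cinner x (P y)"
    and x: "x \<in> S"
  shows "sqrt_op S P x = P x"
proof -
  note SD = closed_csubspaceD[OF S]
  have PS: "P z \<in> S" if "z \<in> S" for z using that P by (rule bounded_opD(1)[rotated])
  have "cinner z (P z) = complex_of_real ((norm (P z))\<^sup>2)" if "z \<in> S" for z
    using sa[OF that PS[OF that]] idem[OF that] by (simp add: cinner_self)
  then have "positive_op S P"
    using P by (simp add: positive_op_def del: of_real_power)
  then have "\<exists>R. positive_op S R \<and> (\<forall>x\<in>S. R (R x) = P x)" using idem by blast
  from someI_ex[OF this]
  have "positive_op S (sqrt_op S P) \<and> (\<forall>x\<in>S. sqrt_op S P (sqrt_op S P x) = P x)"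
    unfolding sqrt_op_def .
  then obtain R where R: "R = sqrt_op S P" "positive_op S R" "\<And>x. x \<in> S \<Longrightarrow> R (R x) = P x"
    by blast
  have b: "bounded_op S S R" using R(2) by (simp add: positive_op_def)
  have RS: "R z \<in> S" if "z \<in> S" for z using that b by (rule bounded_opD(1)[rotated])
  have xP: "x - P x \<in> S" by (intro SD(6) PS x)
  have "cinner (R (x - P x)) (R (x - P x)) = cinner (x - P x) (P (x - P x))"
    using positive_op_self_adjoint[OF S R(2) xP RS[OF xP]] R(3)[OF xP] by simp
  also have "P (x - P x) = 0"
    using x PS by (simp add: bounded_op_diff[OF S P] idem)
  finally have "R (x - P x) = 0" by simp
  then have 1: "R x = R (P x)" using bounded_op_diff[OF S b x PS[OF x]] by simp
  define y where "y = R (P x) - P x"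
  have y: "y \<in> S" unfolding y_def by (intro SD(6) PS RS x)
  have "R y = - y"
    unfolding y_def using x PS RS by (simp add: bounded_op_diff[OF S b] R(3) idem)
  then have "cinner y (R y) = - complex_of_real ((norm y)\<^sup>2)" by (simp add: cinner_self)
  moreover have "cinner y (R y) \<in> \<real>\<^sub>\<ge>\<^sub>0" using R(2) y by (simp add: positive_op_def)
  ultimately have "y = 0" by (simp add: complex_nonneg_Reals_iff)
  then show ?thesis using 1 R(1) by (simp add: y_def)
qed

lemma closed_csubspace_row_space:
  assumes "closed_csubspace H"
  shows "closed_csubspace (row_space H :: ('a::complex_inner ^ 'd::finite) set)"
proof -
  have "row_space H = (\<Inter>j. (\<lambda>x :: 'a ^ 'd. x $ j) -` H)" by (auto simp: row_space_def)
  moreover have "closed (\<Inter>j. (\<lambda>x :: 'a ^ 'd. x $ j) -` H)"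
    by (intro closed_INT ballI closed_vimage closed_csubspaceD(1)[OF assms] continuous_intros)
  ultimately have "closed (row_space H :: ('a ^ 'd) set)" by simp
  then show ?thesis
    using assms by (auto simp: closed_csubspace_def row_space_def scaleC_vec_def)
qed

lemma norm_vec_square: "(norm x)\<^sup>2 = (\<Sum>j\<in>UNIV. (norm (x $ j))\<^sup>2)"
  for x :: "'a::complex_inner ^ 'd::finite"
  by (simp add: norm_vec_def L2_set_def sum_nonneg)

text \<open>
  For a coisometric tuple the row operator \<open>T\<close> satisfies \<open>T T\<^sup>* = I\<close>, so \<open>T\<^sup>*\<close>, called \<open>star\<close> below,
  is an isometry of \<open>H\<close> into \<open>H\<^sup>d\<close>, and \<open>I - T\<^sup>* T\<close>, called \<open>row_proj\<close> below, is the orthogonal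
  projection of \<open>H\<^sup>d\<close> onto the kernel of \<open>T\<close>.
\<close>

locale coisometric =
  fixes H :: "'a::chilbert_space set" and T :: "'d::finite \<Rightarrow> 'a \<Rightarrow> 'a"
  assumes closed: "closed_csubspace H" and tuple: "coisometric_tuple H T"
begin

lemmas HD = closed_csubspaceD[OF closed]

lemma bounded: "bounded_op H H (T j)"
  using tuple by (simp add: coisometric_tuple_def)

lemma row_closed: "closed_csubspace (row_space H :: ('a ^ 'd) set)"
  by (rule closed_csubspace_row_space[OF closed])

definition star :: "'a \<Rightarrow> 'a ^ 'd" where
  "star h = (\<chi> j. adj H (T j) h)"

lemma star_in: "star h \<in> row_space H"
  by (simp add: star_def row_space_def adj(1)[OF closed bounded])

lemma bounded_star: "bounded_op H (row_space H) star"
proof -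
  have "\<exists>K. \<forall>h\<in>H. norm (adj H (T j) h) \<le> K * norm h" for j
    using bounded_opD(4)[OF adj_bounded_op[OF closed bounded]] by blast
  then obtain K where K: "\<And>j h. h \<in> H \<Longrightarrow> norm (adj H (T j) h) \<le> K j * norm h" by metis
  have "norm (star h) \<le> (\<Sum>j\<in>UNIV. K j) * norm h" if "h \<in> H" for h
  proof -
    have "norm (star h) \<le> (\<Sum>j\<in>UNIV. norm (star h $ j))"
      unfolding norm_vec_def by (rule L2_set_le_sum) simp
    also have "\<dots> \<le> (\<Sum>j\<in>UNIV. K j * norm h)"
      using K[OF that] by (intro sum_mono) (simp add: star_def)
    finally show ?thesis by (simp add: sum_distrib_right)
  qed
  then show ?thesis
    unfolding bounded_op_def
    using star_in adj_add[OF closed bounded] adj_scaleC[OF closed bounded]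
    by (auto simp: star_def vec_eq_iff scaleC_vec_def)
qed

lemma row_op_in: "x \<in> row_space H \<Longrightarrow> row_op T x \<in> H"
proof -
  assume "x \<in> row_space H"
  then have "T j (x $ j) \<in> H" for j
    using bounded_opD(1)[OF bounded] by (auto simp: row_space_def)
  moreover have "(\<Sum>j\<in>I. f j) \<in> H" if "\<And>j. f j \<in> H" for I and f :: "'d \<Rightarrow> 'a"
    using that HD(2,3) by (induction I rule: infinite_finite_induct) auto
  ultimately show ?thesis by (simp add: row_op_def)
qed

lemma row_op_star: "h \<in> H \<Longrightarrow> row_op T (star h) = h"
  using tuple by (simp add: coisometric_tuple_def row_op_def star_def)

lemma cinner_row_op:
  assumes "x \<in> row_space H"
  shows "cinner (row_op T x) h = cinner x (star h)"
  using assms by (simp add: row_op_def star_def row_space_def cinner_sum_left cinner_vec_def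
      adj(2)[OF closed bounded])

lemma norm_star: "h \<in> H \<Longrightarrow> norm (star h) = norm h"
proof -
  assume "h \<in> H"
  then have "cinner (star h) (star h) = cinner h h"
    using cinner_row_op[OF star_in, of h h] by (simp add: row_op_star)
  then show ?thesis by (simp add: cinner_self flip: of_real_power)
qed

lemma row_op_diff:
  assumes "x \<in> row_space H" "y \<in> row_space H"
  shows "row_op T (x - y) = row_op T x - row_op T y"
  using assms by (simp add: row_op_def row_space_def bounded_op_diff[OF closed bounded] sum_subtractf)

definition row_proj :: "'a ^ 'd \<Rightarrow> 'a ^ 'd" where
  "row_proj x = x - star (row_op T x)"

lemma row_op_row_proj: "x \<in> row_space H \<Longrightarrow> row_op T (row_proj x) = 0"
  unfolding row_proj_def by (simp add: row_op_diff star_in row_op_star row_op_in)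

lemma star_zero: "star 0 = 0"
  using bounded_opD(3)[OF bounded_star HD(2), of 0] by simp

lemma row_proj_ker: "row_op T x = 0 \<Longrightarrow> row_proj x = x"
  by (simp add: row_proj_def star_zero)

lemma row_proj_in: "x \<in> row_space H \<Longrightarrow> row_proj x \<in> row_space H"
  unfolding row_proj_def using closed_csubspaceD(6)[OF row_closed] star_in by blast

lemma row_proj_self_adjoint:
  assumes "x \<in> row_space H" "y \<in> row_space H"
  shows "cinner (row_proj x) y = cinner x (row_proj y)"
proof -
  have "cinner (star (row_op T x)) y = cinner (row_op T x) (row_op T y)"
    using cinner_row_op[OF assms(2), of "row_op T x"] by (metis cinner_commute)
  then show ?thesis
    by (simp add: row_proj_def cinner_diff_left cinner_diff_right
      cinner_row_op[OF assms(1), symmetric])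
qed

lemma norm_row_proj_le:
  assumes "x \<in> row_space H"
  shows "norm (row_proj x) \<le> norm x"
proof (cases "row_proj x = 0")
  case False
  have "cinner (row_proj x) (row_proj x) = cinner x (row_proj x)"
    using assms by (simp add: row_proj_self_adjoint row_proj_in row_proj_ker row_op_row_proj)
  then have "(norm (row_proj x))\<^sup>2 = inner x (row_proj x)"
    by (metis inner_eq_Re_cinner power2_norm_eq_inner)
  also have "\<dots> \<le> norm x * norm (row_proj x)" by (rule norm_cauchy_schwarz)
  finally show ?thesis using False by (simp add: power2_eq_square)
qed simp

lemma bounded_row_proj: "bounded_op (row_space H) (row_space H) row_proj"
proof -
  have add: "row_op T (x + y) = row_op T x + row_op T y" if "x \<in> row_space H" "y \<in> row_space H" for x y
    using that by (simp add: row_op_def row_space_def bounded_opD(2)[OF bounded] sum.distrib)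
  have "row_op T (a *\<^sub>C x) = a *\<^sub>C row_op T x" if "x \<in> row_space H" for x a
  proof -
    have "(\<Sum>j\<in>I. a *\<^sub>C f j) = a *\<^sub>C (\<Sum>j\<in>I. f j)" for I and f :: "'d \<Rightarrow> 'a"
      by (induction I rule: infinite_finite_induct) (auto simp: scaleC_add_right)
    then show ?thesis
      using that by (simp add: row_op_def row_space_def scaleC_vec_def bounded_opD(3)[OF bounded])
  qed
  moreover have "a *\<^sub>C (x - y) = a *\<^sub>C x - a *\<^sub>C y" for a and x y :: "'a ^ 'd"
    using scaleC_add_right[of a "x - y" y] by (simp add: algebra_simps)
  ultimately show ?thesis
    unfolding bounded_op_def
    using add norm_row_proj_le row_proj_in
    by (auto simp: row_proj_def row_op_in bounded_opD(2,3)[OF bounded_star] intro!: exI[of _ 1])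
qed

text \<open>
  A projection is its own positive square root.
\<close>

lemma defect_op_eq: "x \<in> row_space H \<Longrightarrow> defect_op H T x = row_proj x"
proof -
  assume x: "x \<in> row_space H"
  have "adj (row_space H) (row_op T) h = star h" for h
    by (rule adj_eqI[OF row_closed star_in cinner_row_op])
  then have "defect_op H T = sqrt_op (row_space H) row_proj"
    by (simp add: defect_op_def row_proj_def[abs_def])
  then show ?thesis
    using sqrt_op_projection[OF row_closed bounded_row_proj _ row_proj_self_adjoint x]
    by (simp add: row_proj_ker row_op_row_proj)
qed

text \<open>
  The range of the defect operator is the kernel of \<open>T\<close>, and this is closed, being the orthogonal
  complement of the range of \<open>T\<^sup>*\<close>.
\<close>

lemma defect_space_eq: "defect_space H T = {x \<in> row_space H. row_op T x = 0}"
proof -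
  let ?K = "{x \<in> row_space H. row_op T x = 0}"
  have "defect_op H T ` row_space H = ?K"
  proof
    show "defect_op H T ` row_space H \<subseteq> ?K"
      by (auto simp: defect_op_eq row_proj_in row_op_row_proj)
    show "?K \<subseteq> defect_op H T ` row_space H"
    proof
      fix x assume x: "x \<in> ?K"
      then have "x = defect_op H T x" by (simp add: defect_op_eq row_proj_ker)
      with x show "x \<in> defect_op H T ` row_space H" by blast
    qed
  qed
  moreover have "?K = row_space H \<inter> orth_compl (star ` H)"
  proof -
    have "row_op T x = 0 \<longleftrightarrow> (\<forall>h\<in>H. cinner (star h) x = 0)" if x: "x \<in> row_space H" for x
    proof -
      have "cinner (star h) x = 0 \<longleftrightarrow> cinner (row_op T x) h = 0" for h
        by (simp add: cinner_row_op[OF x] cinner_eq_zero_commute[of "star h"])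
      moreover have "row_op T x = 0 \<longleftrightarrow> (\<forall>h\<in>H. cinner (row_op T x) h = 0)"
        using row_op_in[OF x] by force
      ultimately show ?thesis by simp
    qed
    then show ?thesis by (auto simp: orth_compl_def)
  qed
  moreover have "closed (row_space H \<inter> orth_compl (star ` H))"
    by (intro closed_Int closed_csubspaceD(1) row_closed closed_csubspace_orth_compl)
  ultimately show ?thesis unfolding defect_space_def by (metis closure_closed)
qed

lemma closed_csubspace_defect_space: "closed_csubspace (defect_space H T)"
proof -
  have "x \<in> row_space H \<Longrightarrow> row_op T x = 0 \<longleftrightarrow> row_proj x = x" for x
    by (metis row_op_row_proj row_proj_ker)
  then have "defect_space H T = {x \<in> row_space H. row_proj x = x}"
    by (auto simp: defect_space_eq)
  moreover have "closed (defect_space H T)" by (simp add: defect_space_def)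
  ultimately show ?thesis
    using closed_csubspaceD(2-4)[OF row_closed] bounded_opD(2,3)[OF bounded_row_proj]
      bounded_opD(3)[OF bounded_row_proj closed_csubspaceD(2)[OF row_closed], of 0]
    by (auto simp: closed_csubspace_def)
qed

text \<open>
  The defect operator acts as the identity on the defect space, so the adjoint of its restriction
  to the \<open>j\<close>-th summand only extracts the \<open>j\<close>-th component.
\<close>

lemma adj_defect_comp:
  assumes y: "y \<in> defect_space H T"
  shows "adj H (defect_comp H T j) y = y $ j"
proof (rule adj_eqI[OF closed])
  have y': "y \<in> row_space H" "row_op T y = 0" using y by (auto simp: defect_space_eq)
  then show "y $ j \<in> H" by (simp add: row_space_def)
  fix h assume h: "h \<in> H"
  have ax: "axis j h \<in> row_space H" using h HD(2) by (simp add: row_space_def axis_def)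
  have "cinner (defect_comp H T j h) y = cinner (axis j h) y"
    using y' ax by (simp add: defect_comp_def defect_op_eq row_proj_self_adjoint row_proj_ker)
  also have "\<dots> = (\<Sum>i\<in>UNIV. if i = j then cinner h (y $ j) else 0)"
    unfolding cinner_vec_def by (intro sum.cong) (auto simp: axis_def)
  finally show "cinner (defect_comp H T j h) y = cinner h (y $ j)" by simp
qed

lemma cinner_star_defect: "y \<in> defect_space H T \<Longrightarrow> cinner (star h) y = 0"
  using cinner_row_op[of y h] by (simp add: defect_space_eq cinner_eq_zero_commute[of "star h"])

text \<open>
  Since \<open>H\<^sup>d\<close> is the orthogonal sum of the range of \<open>T\<^sup>*\<close> and the kernel of \<open>T\<close>, the map
  \<open>(h, y) \<mapsto> T\<^sup>* h + y\<close> is unitary from \<open>H \<oplus> \<D>\<^sub>T\<close> to \<open>H\<^sup>d\<close>.  The \<open>n\<close>-th step operator is this map,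
  applied separately for each word of length \<open>n - 1\<close>.
\<close>

lemma norm_star_add_defect:
  assumes "h \<in> H" "y \<in> defect_space H T"
  shows "(norm (star h + y))\<^sup>2 = (norm h)\<^sup>2 + (norm y)\<^sup>2"
proof -
  have "inner (star h) y = 0" using cinner_star_defect[OF assms(2)] by (simp add: inner_eq_Re_cinner)
  then have "(norm (star h + y))\<^sup>2 = (norm (star h))\<^sup>2 + (norm y)\<^sup>2"
    by (simp add: power2_norm_eq_inner inner_add_left inner_add_right inner_commute)
  then show ?thesis by (simp add: norm_star assms)
qed

end


section \<open>Spaces of square summable families\<close>

lemma scaleC_vec_component: "(a *\<^sub>C x) $ i = a *\<^sub>C (x $ i)"
  by (simp add: scaleC_vec_def)

text \<open>
  Pythagoras' theorem for splitting off finitely many coordinates; \<open>z\<close> is the remaining part of \<open>y\<close>.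
\<close>

lemma norm_coord_split:
  fixes y z :: "('i, 'a::complex_inner) ell2"
  assumes A: "finite A" and z: "\<And>i. coord z i = (if i \<in> A then 0 else coord y i)"
  shows "(norm y)\<^sup>2 = (\<Sum>i\<in>A. (norm (coord y i))\<^sup>2) + (norm z)\<^sup>2"
proof -
  have "(norm y)\<^sup>2 = (\<Sum>\<^sub>\<infinity>i\<in>A \<union> - A. (norm (coord y i))\<^sup>2)"
    by (simp add: norm_ell2_square Un_commute)
  also have "\<dots> = (\<Sum>\<^sub>\<infinity>i\<in>A. (norm (coord y i))\<^sup>2) + (\<Sum>\<^sub>\<infinity>i\<in>- A. (norm (coord y i))\<^sup>2)"
    by (intro infsum_Un_disjoint summable_on_subset_banach[OF ell2_summable]) auto
  also have "(\<Sum>\<^sub>\<infinity>i\<in>- A. (norm (coord y i))\<^sup>2) = (norm z)\<^sup>2"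
    unfolding norm_ell2_square by (intro infsum_cong_neutral) (auto simp: z)
  finally show ?thesis using A by simp
qed

lemma coord_Abs_ell2:
  fixes z :: "('i, 'a::complex_inner) ell2"
  assumes A: "finite A" and f: "\<And>i. i \<notin> A \<Longrightarrow> norm (f i) \<le> norm (coord z i)"
  shows "coord (Abs_ell2 f) = f"
proof -
  have "(\<lambda>i. (norm (f i))\<^sup>2) summable_on - A"
    by (rule summable_on_comparison_test[OF summable_on_subset_banach[OF ell2_summable[of z]]])
      (use f in \<open>auto intro: power_mono\<close>)
  then have "(\<lambda>i. (norm (f i))\<^sup>2) summable_on (A \<union> - A)"
    by (intro summable_on_Un_disjoint) (use A in auto)
  then show ?thesis by (simp add: Abs_ell2_inverse Un_commute)
qed

lemma continuous_on_coord [continuous_intros]: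
  fixes f :: "'x::topological_space \<Rightarrow> ('i, 'a::complex_inner) ell2"
  assumes "continuous_on S f"
  shows "continuous_on S (\<lambda>x. coord (f x) i)"
proof (rule bounded_linear.continuous_on[OF _ assms])
  show "bounded_linear (\<lambda>x :: ('i, 'a) ell2. coord x i)"
    by (rule bounded_linear_intro[of _ 1]) (auto simp: norm_coord_le)
qed

text \<open>
  Every space of the construction arises by prescribing a closed subspace for each coordinate.
\<close>

lemma closed_csubspace_families:
  fixes A :: "'i \<Rightarrow> 'a::complex_inner set" and B :: "'j \<Rightarrow> 'b::complex_inner set"
  assumes A: "\<And>i. closed_csubspace (A i)" and B: "\<And>j. closed_csubspace (B j)"
  shows "closed_csubspace {(f, y). (\<forall>i. coord f i \<in> A i) \<and> (\<forall>j. coord y j \<in> B j)}"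
proof -
  have "{(f, y). (\<forall>i. coord f i \<in> A i) \<and> (\<forall>j. coord y j \<in> B j)}
      = (\<Inter>i. (\<lambda>p. coord (fst p) i) -` A i) \<inter> (\<Inter>j. (\<lambda>p. coord (snd p) j) -` B j)"
    by auto
  moreover have "closed \<dots>"
    using closed_csubspaceD(1)[OF A] closed_csubspaceD(1)[OF B]
    by (intro closed_Int closed_INT ballI closed_vimage continuous_intros)
  ultimately show ?thesis
    using closed_csubspaceD(2-4)[OF A] closed_csubspaceD(2-4)[OF B]
    by (auto simp: closed_csubspace_def scaleC_prod_def)
qed

lemma all_mem_if_singleton:
  assumes "z \<in> A"
  shows "(\<forall>i. x i \<in> (if P i then A else {z})) \<longleftrightarrow> (\<forall>i. x i \<in> A) \<and> (\<forall>i. \<not> P i \<longrightarrow> x i = z)"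
  by (rule iffI; rule conjI allI; metis assms singletonI singletonD)

lemma closed_csubspace_zero: "closed_csubspace {0}"
  by (simp add: closed_csubspace_def)

lemma finite_words: "finite {w :: 'd::finite list. length w = n}"
  using finite_lists_length_eq[of "UNIV :: 'd set" n] by simp

lemma finite_words_less: "finite {w :: 'd::finite list. length w < n}"
  by (rule finite_subset[OF _ finite_lists_length_le[of "UNIV :: 'd set" n]]) auto

lemma sum_words_Suc:
  "(\<Sum>w | length w = Suc n. g (butlast w) (last w)) = (\<Sum>v | length v = n. \<Sum>j\<in>UNIV. g v j)"
  for g :: "'d::finite list \<Rightarrow> 'd \<Rightarrow> 'b::comm_monoid_add"
proof -
  have "(\<Sum>v | length v = n. \<Sum>j\<in>UNIV. g v j)
      = (\<Sum>(v, j)\<in>{v. length v = n} \<times> UNIV. g v j)"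
    by (rule sum.cartesian_product)
  also have "\<dots> = (\<Sum>w | length w = Suc n. g (butlast w) (last w))"
    by (rule sum.reindex_bij_witness[of _ "\<lambda>w. (butlast w, last w)" "\<lambda>(v, j). v @ [j]"])
      (auto, metis append_butlast_last_id length_0_conv nat.distinct(1))
  finally show ?thesis by simp
qed

lemma closed_csubspace_HP_space:
  assumes "closed_csubspace H"
  shows "closed_csubspace (HP_space H n :: ('d::finite, 'a::chilbert_space) ambient set)"
proof -
  have "HP_space H n = {(f, y :: ('d list, 'a ^ 'd) ell2).
      (\<forall>w. coord f w \<in> (if length w = n then H else {0})) \<and> (\<forall>\<alpha>. coord y \<alpha> \<in> {0})}"
    unfolding all_mem_if_singleton[OF closed_csubspaceD(2)[OF assms]]
    by (auto simp: HP_space_def intro: ell2_cong)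
  also have "closed_csubspace \<dots>"
    by (rule closed_csubspace_families) (simp_all add: assms closed_csubspace_zero)
  finally show ?thesis .
qed

definition trunc :: "nat \<Rightarrow> ('d::finite list, 'a::complex_inner) ell2 \<Rightarrow> ('d list, 'a) ell2" where
  "trunc n y = Abs_ell2 (\<lambda>\<alpha>. if length \<alpha> < n then coord y \<alpha> else 0)"

lemma coord_trunc: "coord (trunc n y) \<alpha> = (if length \<alpha> < n then coord y \<alpha> else 0)"
  by (simp add: trunc_def coord_Abs_ell2[of "{}" _ y])

text \<open>
  A finite set of words that carries almost all of \<open>\<parallel>y\<parallel>\<^sup>2\<close> consists of words of bounded length.
\<close>

lemma trunc_tendsto: "(\<lambda>n. trunc n y) \<longlonglongrightarrow> y"
proof (rule metric_LIMSEQ_I)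
  fix e :: real assume "0 < e"
  have "((\<lambda>\<alpha>. (norm (coord y \<alpha>))\<^sup>2) has_sum (norm y)\<^sup>2) UNIV"
    unfolding norm_ell2_square using ell2_summable by (rule has_sum_infsum)
  from has_sum_finite_approximation[OF this, of "e\<^sup>2 / 2"] \<open>0 < e\<close>
  obtain F where F: "finite F"
    "dist (\<Sum>\<alpha>\<in>F. (norm (coord y \<alpha>))\<^sup>2) ((norm y)\<^sup>2) \<le> e\<^sup>2 / 2"
    by auto
  moreover have "0 < e\<^sup>2" using \<open>0 < e\<close> by simp
  ultimately have F2: "(norm y)\<^sup>2 - e\<^sup>2 < (\<Sum>\<alpha>\<in>F. (norm (coord y \<alpha>))\<^sup>2)"
    unfolding dist_real_def by linarith
  obtain N where N: "\<forall>\<alpha>\<in>F. length \<alpha> < N"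
    using finite_nat_set_iff_bounded[of "length ` F"] F(1) by auto
  have "dist (trunc n y) y < e" if "N \<le> n" for n
  proof -
    let ?A = "{\<alpha> :: 'a list. length \<alpha> < n}"
    have "(norm y)\<^sup>2 = (\<Sum>\<alpha>\<in>?A. (norm (coord y \<alpha>))\<^sup>2) + (norm (y - trunc n y))\<^sup>2"
      by (rule norm_coord_split) (auto simp: finite_words_less coord_trunc)
    moreover have "(\<Sum>\<alpha>\<in>F. (norm (coord y \<alpha>))\<^sup>2) \<le> (\<Sum>\<alpha>\<in>?A. (norm (coord y \<alpha>))\<^sup>2)"
      using N that by (intro sum_mono2 finite_words_less) fastforce+
    ultimately have "(norm (y - trunc n y))\<^sup>2 < e\<^sup>2" using F2 by linarith
    then show ?thesis
      using \<open>0 < e\<close> by (simp add: dist_norm norm_minus_commute power_less_imp_less_base)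
  qed
  then show "\<exists>N. \<forall>n\<ge>N. dist (trunc n y) y < e" by blast
qed


section \<open>Unitarity of the step operators and truncation\<close>

lemma coord_snd_U_prod:
  fixes T :: "'d::finite \<Rightarrow> 'a::chilbert_space \<Rightarrow> 'a"
  shows "coord (snd (U_prod H T n x)) \<alpha> =
    (if n \<le> length \<alpha> then coord (snd x) \<alpha> else 0)"
proof (induction n)
  case (Suc n)
  then show ?case
    by (cases "U_prod H T n x") (auto simp: coord_U_op)
qed simp

text \<open>
  Each step feeds the coordinates at words of one length into the first component, so after \<open>n\<close>
  steps the coordinates at words of length at least \<open>n\<close> have had no influence on it.
\<close>

lemma fst_U_prod_cong:
  fixes T :: "'d::finite \<Rightarrow> 'a::chilbert_space \<Rightarrow> 'a"
  assumes "fst x = fst x'" "\<And>\<alpha>. length \<alpha> < n \<Longrightarrow> coord (snd x) \<alpha> = coord (snd x') \<alpha>"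
  shows "fst (U_prod H T n x) = fst (U_prod H T n x')"
  using assms(2)
proof (induction n)
  case (Suc n)
  obtain f y where fy: "U_prod H T n x = (f, y)" by (cases "U_prod H T n x")
  obtain f' y' where fy': "U_prod H T n x' = (f', y')" by (cases "U_prod H T n x'")
  have "fst (U_prod H T n x) = fst (U_prod H T n x')" using Suc by simp
  moreover have "coord y v = coord y' v" if "length v = n" for v
    using coord_snd_U_prod[of H T n x v] coord_snd_U_prod[of H T n x' v] Suc.prems[of v]
    by (simp add: fy fy' that)
  ultimately show ?case
    by (intro ell2_cong) (simp add: fy fy' coord_U_op)
qed (simp add: assms(1))

context coisometric
begin

lemma level_closed: "closed_csubspace (level_space H T n)"
proof -
  have "level_space H T n = {(f, y).
      (\<forall>w. coord f w \<in> (if length w = n then H else {0})) \<and>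
      (\<forall>\<alpha>. coord y \<alpha> \<in> (if n \<le> length \<alpha> then defect_space H T else {0}))}"
    unfolding all_mem_if_singleton[OF HD(2)]
      all_mem_if_singleton[OF closed_csubspaceD(2)[OF closed_csubspace_defect_space]]
    by (auto simp: level_space_def)
  also have "closed_csubspace \<dots>"
    by (rule closed_csubspace_families)
      (simp_all add: closed closed_csubspace_defect_space closed_csubspace_zero)
  finally show ?thesis .
qed

lemma star_add: "h \<in> H \<Longrightarrow> k \<in> H \<Longrightarrow> star (h + k) = star h + star k"
  and star_scaleC: "h \<in> H \<Longrightarrow> star (a *\<^sub>C h) = a *\<^sub>C star h"
  using bounded_opD(2,3)[OF bounded_star] by blast+

text \<open>
  The \<open>d\<close> coordinates at the words \<open>v j\<close> with \<open>v\<close> fixed are the components of the single vector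
  \<open>T\<^sup>* h\<^sub>v + y\<^sub>v\<close>; in this form the unitarity of \<open>(h, y) \<mapsto> T\<^sup>* h + y\<close> can be used.
\<close>

lemma coord_fst_U_op:
  assumes "(f, y) \<in> level_space H T n"
  shows "coord (fst (U_op H T (Suc n) (f, y))) w =
    (if length w = Suc n then (star (coord f (butlast w)) + coord y (butlast w)) $ last w else 0)"
  using assms by (simp add: coord_U_op level_space_def adj_defect_comp star_def)

lemma U_op_in:
  assumes x: "x \<in> level_space H T n"
  shows "U_op H T (Suc n) x \<in> level_space H T (Suc n)"
proof -
  obtain f y where fy: "x = (f, y)" by (cases x)
  have "star h + k \<in> row_space H" if "k \<in> defect_space H T" for h k
    using that closed_csubspaceD(3)[OF row_closed star_in] by (simp add: defect_space_eq)
  then have "coord (fst (U_op H T (Suc n) x)) w \<in> H" for w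
    using x HD(2) unfolding fy coord_fst_U_op[OF x[unfolded fy]]
    by (auto simp: level_space_def row_space_def)
  then show ?thesis
    using x closed_csubspaceD(2)[OF closed_csubspace_defect_space]
    by (auto simp: fy level_space_def case_prod_beta coord_U_op)
qed

lemma U_op_linear:
  assumes x: "x \<in> level_space H T n" and x': "x' \<in> level_space H T n"
  shows "U_op H T (Suc n) (x + x') = U_op H T (Suc n) x + U_op H T (Suc n) x'"
    and "U_op H T (Suc n) (a *\<^sub>C x) = a *\<^sub>C U_op H T (Suc n) x"
proof -
  obtain f y where fy: "x = (f, y)" by (cases x)
  obtain f' y' where fy': "x' = (f', y')" by (cases x')
  have add: "(f + f', y + y') \<in> level_space H T n" and scale: "(a *\<^sub>C f, a *\<^sub>C y) \<in> level_space H T n"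
    using closed_csubspaceD(3)[OF level_closed x x'] closed_csubspaceD(4)[OF level_closed x]
    by (simp_all add: fy fy' scaleC_prod_def)
  have H: "coord f w \<in> H" "coord f' w \<in> H" for w
    using x x' by (auto simp: fy fy' level_space_def)
  show "U_op H T (Suc n) (x + x') = U_op H T (Suc n) x + U_op H T (Suc n) x'"
    by (intro prod_eqI ell2_cong)
      (simp_all add: fy fy' coord_fst_U_op[OF add] coord_fst_U_op[OF x[unfolded fy]]
        coord_fst_U_op[OF x'[unfolded fy']] coord_U_op(2) star_add H)
  show "U_op H T (Suc n) (a *\<^sub>C x) = a *\<^sub>C U_op H T (Suc n) x"
    by (intro prod_eqI ell2_cong)
      (simp_all add: fy scaleC_prod_def coord_fst_U_op[OF scale] coord_fst_U_op[OF x[unfolded fy]]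
        coord_U_op(2) star_scaleC H scaleC_add_right scaleC_vec_component)
qed

lemma norm_U_op:
  assumes x: "x \<in> level_space H T n"
  shows "norm (U_op H T (Suc n) x) = norm x"
proof -
  obtain f y where fy: "x = (f, y)" by (cases x)
  define f' y' where "f' = fst (U_op H T (Suc n) x)" and "y' = snd (U_op H T (Suc n) x)"
  let ?r = "\<lambda>v. star (coord f v) + coord y v"
  have f': "coord f' w = (if length w = Suc n then ?r (butlast w) $ last w else 0)" for w
    unfolding f'_def fy by (rule coord_fst_U_op[OF x[unfolded fy]])
  have y': "coord y' \<alpha> = (if \<alpha> \<in> {\<alpha>. length \<alpha> = n} then 0 else coord y \<alpha>)" for \<alpha>
    using x by (auto simp: y'_def fy coord_U_op level_space_def)
  have "(norm f')\<^sup>2 = (\<Sum>w | length w = Suc n. (norm (coord f' w))\<^sup>2) + (norm (0 :: ('d list, 'a) ell2))\<^sup>2"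
    by (rule norm_coord_split) (auto simp: f' finite_words)
  also have "\<dots> = (\<Sum>w | length w = Suc n. (norm (?r (butlast w) $ last w))\<^sup>2)"
    by (simp add: f')
  also have "\<dots> = (\<Sum>v | length v = n. (norm (?r v))\<^sup>2)"
    unfolding norm_vec_square by (rule sum_words_Suc)
  also have "\<dots> = (\<Sum>v | length v = n. (norm (coord f v))\<^sup>2) + (\<Sum>v | length v = n. (norm (coord y v))\<^sup>2)"
    using x by (simp add: fy level_space_def norm_star_add_defect sum.distrib)
  also have "(\<Sum>v | length v = n. (norm (coord f v))\<^sup>2) = (norm f)\<^sup>2"
    using norm_coord_split[of "{v. length v = n}" 0 f] x
    by (simp add: finite_words fy level_space_def)
  finally have "(norm f')\<^sup>2 + (norm y')\<^sup>2 = (norm f)\<^sup>2 + (norm y)\<^sup>2"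
    using norm_coord_split[of "{v. length v = n}" y' y, OF finite_words y'] by simp
  moreover have "U_op H T (Suc n) x = (f', y')" by (simp add: f'_def y'_def)
  ultimately show ?thesis by (simp add: fy norm_Pair)
qed

text \<open>
  The components at the words \<open>v j\<close> form a vector \<open>r\<close> of \<open>H\<^sup>d\<close>, and \<open>r = T\<^sup>* (T r) + (r - T\<^sup>* T r)\<close> is its
  decomposition along the range of \<open>T\<^sup>*\<close> and the defect space.
\<close>

lemma U_op_surj:
  assumes x: "x \<in> level_space H T (Suc n)"
  shows "x \<in> U_op H T (Suc n) ` level_space H T n"
proof -
  obtain g z where gz: "x = (g, z)" by (cases x)
  define r :: "'d list \<Rightarrow> 'a ^ 'd" where "r v = (\<chi> j. coord g (v @ [j]))" for v
  define f where "f = Abs_ell2 (\<lambda>v. if length v = n then row_op T (r v) else 0)"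
  define y where "y = Abs_ell2 (\<lambda>v. if length v = n then row_proj (r v) else coord z v)"
  have f: "coord f v = (if length v = n then row_op T (r v) else 0)" for v
    unfolding f_def by (subst coord_Abs_ell2[OF finite_words, of n _ 0]) auto
  have y: "coord y v = (if length v = n then row_proj (r v) else coord z v)" for v
    unfolding y_def by (subst coord_Abs_ell2[OF finite_words, of n _ z]) auto
  have r: "r v \<in> row_space H" for v using x by (auto simp: r_def row_space_def gz level_space_def)
  then have "row_proj (r v) \<in> defect_space H T" for v
    by (simp add: defect_space_eq row_proj_in row_op_row_proj)
  then have fy: "(f, y) \<in> level_space H T n"
    using x HD(2) r by (auto simp: level_space_def gz f y row_op_in)
  have "U_op H T (Suc n) (f, y) = x"
  proof (intro prod_eqI ell2_cong)
    fix w :: "'d list"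
    have "butlast w @ [last w] = w" if "length w = Suc n"
      using that by (intro append_butlast_last_id) auto
    then show "coord (fst (U_op H T (Suc n) (f, y))) w = coord (fst x) w"
      using x by (simp add: coord_fst_U_op[OF fy] f y row_proj_def) (simp add: r_def gz level_space_def)
  next
    fix \<alpha> :: "'d list"
    show "coord (snd (U_op H T (Suc n) (f, y))) \<alpha> = coord (snd x) \<alpha>"
      using x by (simp add: coord_U_op y gz level_space_def)
  qed
  with fy show ?thesis by blast
qed

lemma unitary_U_op: "unitary_op (level_space H T n) (level_space H T (Suc n)) (U_op H T (Suc n))"
  using U_op_in U_op_linear norm_U_op U_op_surj
  by (auto simp: unitary_op_def isometry_op_def bounded_op_def intro!: exI[of _ 1])

lemma hat_closed: "closed_csubspace (hat_space H T)"
  unfolding hat_space_def by (rule level_closed)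

lemma unitary_U_prod: "unitary_op (hat_space H T) (level_space H T n) (U_prod H T n)"
proof (induction n)
  case 0
  show ?case
    by (auto simp: hat_space_def unitary_op_def isometry_op_def bounded_op_def intro!: exI[of _ 1])
next
  case (Suc n)
  then show ?case unfolding U_prod.simps by (rule unitary_op_comp[OF _ unitary_U_op])
qed

lemma U_prod_in: "x \<in> hat_space H T \<Longrightarrow> U_prod H T n x \<in> level_space H T n"
  using unitary_U_prod[of n] by (auto simp: unitary_op_def)

lemma U_adj_prod_U_prod: "x \<in> hat_space H T \<Longrightarrow> U_adj_prod H T n (U_prod H T n x) = x"
  by (induction n) (auto simp: unitary_op_adj[OF level_closed unitary_U_op] U_prod_in)

lemma U_adj_prod:
  assumes "z \<in> level_space H T n"
  shows "U_adj_prod H T n z \<in> hat_space H T" "U_prod H T n (U_adj_prod H T n z) = z"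
proof -
  obtain x where "x \<in> hat_space H T" "z = U_prod H T n x"
    using assms unitary_U_prod[of n] unfolding unitary_op_def by blast
  then show "U_adj_prod H T n z \<in> hat_space H T" "U_prod H T n (U_adj_prod H T n z) = z"
    by (simp_all add: U_adj_prod_U_prod)
qed

lemma cinner_U_prod:
  assumes "x \<in> hat_space H T" "z \<in> level_space H T n"
  shows "cinner (U_prod H T n x) z = cinner x (U_adj_prod H T n z)"
  using isometry_op_cinner[OF hat_closed _ assms(1) U_adj_prod(1)[OF assms(2)]]
    unitary_U_prod[of n] U_adj_prod(2)[OF assms(2)] by (fastforce simp: unitary_op_def)

lemma isometry_U_adj_prod: "isometry_op (level_space H T n) (hat_space H T) (U_adj_prod H T n)"
proof -
  note SD = closed_csubspaceD[OF hat_closed]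
  have U: "bounded_op (hat_space H T) (level_space H T n) (U_prod H T n)"
    and nrm: "\<And>x. x \<in> hat_space H T \<Longrightarrow> norm (U_prod H T n x) = norm x"
    using unitary_U_prod[of n] by (auto simp: unitary_op_def isometry_op_def)
  have n: "norm (U_adj_prod H T n z) = norm z" if "z \<in> level_space H T n" for z
    using nrm[of "U_adj_prod H T n z"] U_adj_prod[OF that] by simp
  have "U_adj_prod H T n (z + z') = U_adj_prod H T n z + U_adj_prod H T n z'"
    if "z \<in> level_space H T n" "z' \<in> level_space H T n" for z z'
  proof -
    have "z + z' = U_prod H T n (U_adj_prod H T n z + U_adj_prod H T n z')"
      using that by (simp add: bounded_opD(2)[OF U] U_adj_prod)
    then show ?thesis using that by (simp add: U_adj_prod_U_prod SD(3) U_adj_prod(1))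
  qed
  moreover have "U_adj_prod H T n (a *\<^sub>C z) = a *\<^sub>C U_adj_prod H T n z"
    if "z \<in> level_space H T n" for z a
  proof -
    have "a *\<^sub>C z = U_prod H T n (a *\<^sub>C U_adj_prod H T n z)"
      using that by (simp add: bounded_opD(3)[OF U] U_adj_prod)
    then show ?thesis using that by (simp add: U_adj_prod_U_prod SD(4) U_adj_prod(1))
  qed
  ultimately show ?thesis
    using n U_adj_prod(1) by (auto simp: isometry_op_def bounded_op_def intro!: exI[of _ 1])
qed

abbreviation Q_space :: "nat \<Rightarrow> ('d, 'a) ambient set" where
  "Q_space n \<equiv> {(f, y) \<in> hat_space H T. \<forall>\<alpha>. n \<le> length \<alpha> \<longrightarrow> coord y \<alpha> = 0}"

lemma Q_space_closed: "closed_csubspace (Q_space n)"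
proof -
  have "Q_space n = {(f, y).
      (\<forall>w. coord f w \<in> (if length w = 0 then H else {0})) \<and>
      (\<forall>\<alpha>. coord y \<alpha> \<in> (if length \<alpha> < n then defect_space H T else {0}))}"
    unfolding all_mem_if_singleton[OF HD(2)]
      all_mem_if_singleton[OF closed_csubspaceD(2)[OF closed_csubspace_defect_space]]
    by (auto simp: hat_space_def level_space_def)
  also have "closed_csubspace \<dots>"
    by (rule closed_csubspace_families)
      (simp_all add: closed closed_csubspace_defect_space closed_csubspace_zero)
  finally show ?thesis .
qed

text \<open>
  The projection onto words of length less than \<open>n\<close> is the truncation of the Fock space component.
\<close>

lemma Q_proj_eq:
  assumes x: "x \<in> hat_space H T"
  shows "Q_proj H T n x = (fst x, trunc n (snd x))"
  unfolding Q_proj_def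
proof (rule orth_proj_eqI[OF Q_space_closed])
  show "(fst x, trunc n (snd x)) \<in> Q_space n"
    using x closed_csubspaceD(2)[OF closed_csubspace_defect_space]
    by (auto simp: hat_space_def level_space_def coord_trunc)
  have "cinner y (snd x - trunc n (snd x)) = 0" if "\<forall>\<alpha>. n \<le> length \<alpha> \<longrightarrow> coord y \<alpha> = 0" for y
    unfolding cinner_ell2_def using that by (intro infsum_0) (auto simp: coord_trunc)
  then show "x - (fst x, trunc n (snd x)) \<in> orth_compl (Q_space n)"
    by (auto simp: orth_compl_def cinner_prod_def)
qed

lemma Q_proj_in: "Q_proj H T n x \<in> Q_space n"
  unfolding Q_proj_def by (rule orth_proj(1)[OF Q_space_closed])

lemma Q_proj_in_hat: "Q_proj H T n x \<in> hat_space H T"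
  using Q_proj_in[of n x] by auto

lemma Q_proj_tendsto:
  assumes "x \<in> hat_space H T"
  shows "(\<lambda>n. Q_proj H T n x) \<longlonglongrightarrow> x"
  using tendsto_Pair[OF tendsto_const trunc_tendsto, of "fst x" "snd x"] assms
  by (simp add: Q_proj_eq)

lemma U_prod_Q_space:
  assumes "x \<in> Q_space n"
  shows "U_prod H T n x \<in> HP_space H n"
proof -
  have "snd (U_prod H T n x) = 0"
    using assms by (intro ell2_cong) (auto simp: coord_snd_U_prod)
  moreover have "U_prod H T n x \<in> level_space H T n" using assms U_prod_in by blast
  ultimately show ?thesis by (auto simp: HP_space_def level_space_def)
qed

lemma HP_space_subset: "HP_space H n \<subseteq> level_space H T n"
  using closed_csubspaceD(2)[OF closed_csubspace_defect_space]
  by (auto simp: HP_space_def level_space_def)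

end


section \<open>Limits of isometries on increasing subspaces\<close>

text \<open>
  Since \<open>V m (Q n x)\<close> does not depend on \<open>m \<ge> n\<close>, the vectors \<open>V m x\<close> and \<open>V n x\<close> differ by
  \<open>V m (x - Q n x)\<close>, of norm at most \<open>\<parallel>x - Q n x\<parallel>\<close>: the sequence is Cauchy.
\<close>

lemma isometry_op_limit:
  fixes S' :: "'b::chilbert_space set"
  assumes S: "closed_csubspace S" and S': "closed_csubspace S'"
    and Q: "\<And>n x. x \<in> S \<Longrightarrow> Q n x \<in> S" "\<And>n x. x \<in> S \<Longrightarrow> norm (Q n x) \<le> norm x"
      "\<And>x. x \<in> S \<Longrightarrow> (\<lambda>n. Q n x) \<longlonglongrightarrow> x"
    and V: "\<And>n. bounded_op S S' (V n)" "\<And>n x. x \<in> S \<Longrightarrow> norm (V n x) = norm (Q n x)"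
      "\<And>m n x. x \<in> S \<Longrightarrow> n \<le> m \<Longrightarrow> V m (Q n x) = V n x"
  shows "\<exists>L. isometry_op S S' L \<and> (\<forall>x\<in>S. (\<lambda>n. V n x) \<longlonglongrightarrow> L x) \<and> (\<forall>x\<in>S. \<forall>n. L (Q n x) = V n x)"
proof -
  have est: "dist (V m x) (V n x) \<le> dist (Q n x) x" if "x \<in> S" "n \<le> m" for m n x
  proof -
    have d: "x - Q n x \<in> S" using that(1) Q(1) closed_csubspaceD(6)[OF S] by simp
    have "V m x - V n x = V m (x - Q n x)"
      using that by (simp add: bounded_op_diff[OF S V(1)] Q(1) V(3))
    then show ?thesis using Q(2)[OF d, of m] V(2)[OF d, of m] by (simp add: dist_norm norm_minus_commute)
  qed
  have "convergent (\<lambda>n. V n x)" if x: "x \<in> S" for x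
  proof (rule Cauchy_convergent, rule metric_CauchyI)
    fix e :: real assume "0 < e"
    then obtain N where N: "dist (Q N x) x < e / 2"
      using metric_LIMSEQ_D[OF Q(3)[OF x], of "e / 2"] by auto
    have "dist (V m x) (V n x) < e" if "N \<le> m" "N \<le> n" for m n
      using est[OF x that(1)] est[OF x that(2)] N dist_triangle2[of "V m x" "V n x" "V N x"]
      by linarith
    then show "\<exists>M. \<forall>m\<ge>M. \<forall>n\<ge>M. dist (V m x) (V n x) < e" by blast
  qed
  then obtain L where L: "\<And>x. x \<in> S \<Longrightarrow> (\<lambda>n. V n x) \<longlonglongrightarrow> L x"
    unfolding convergent_def by metis
  have "norm (L x) = norm x" if x: "x \<in> S" for x
    using LIMSEQ_unique[OF tendsto_norm[OF L[OF x]]] tendsto_norm[OF Q(3)[OF x]] V(2)[OF x] by simp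
  moreover have "L x \<in> S'" if x: "x \<in> S" for x
    by (rule closed_sequentially[OF closed_csubspaceD(1)[OF S'] _ L[OF x]])
      (use x bounded_opD(1)[OF V(1)] in blast)
  moreover have "L (x + y) = L x + L y" if "x \<in> S" "y \<in> S" for x y
    using LIMSEQ_unique[OF L[OF closed_csubspaceD(3)[OF S that]]]
      tendsto_add[OF L[OF that(1)] L[OF that(2)]] that
    by (simp add: bounded_opD(2)[OF V(1)])
  moreover have "L (a *\<^sub>C x) = a *\<^sub>C L x" if "x \<in> S" for a x
  proof -
    have "bounded_linear (\<lambda>x :: 'b. a *\<^sub>C x)"
      by (rule bounded_linear_intro[of _ "cmod a"])
        (simp_all add: scaleC_add_right scaleR_eq_scaleC scaleC_scaleC mult.commute norm_scaleC)
    from bounded_linear.tendsto[OF this L[OF that]]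
    show ?thesis
      using LIMSEQ_unique[OF L[OF closed_csubspaceD(4)[OF S that]]] that
      by (simp add: bounded_opD(3)[OF V(1)])
  qed
  ultimately have "isometry_op S S' L"
    by (auto simp: isometry_op_def bounded_op_def intro!: exI[of _ 1])
  moreover have "L (Q n x) = V n x" if x: "x \<in> S" for n x
  proof (rule LIMSEQ_unique[OF L[OF Q(1)[OF x]]])
    show "(\<lambda>m. V m (Q n x)) \<longlonglongrightarrow> V n x"
      by (rule tendsto_eventually, rule eventually_sequentiallyI[of n]) (simp add: V(3) x)
  qed
  ultimately show ?thesis using L by blast
qed


section \<open>The limit for a coisometric lifting\<close>

locale lifting = C: coisometric HC C + E: coisometric UNIV E
  for HC :: "'a::chilbert_space set" and C E :: "'d::finite \<Rightarrow> 'a \<Rightarrow> 'a" +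
  assumes lifting: "coisometric_lifting HC C E"
begin

text \<open>
  The block triangular form of \<open>E j\<close> says that \<open>HC\<close> is invariant under the adjoint and that the
  adjoint restricts there to that of \<open>C j\<close>.
\<close>

lemma adj_lifting:
  assumes h: "h \<in> HC"
  shows "adj UNIV (E j) h = adj HC (C j) h"
proof (rule adj_eqI[OF E.closed])
  fix s :: 'a
  obtain B A where BA: "bounded_op HC (orth_compl HC) (B j)"
      "bounded_op (orth_compl HC) (orth_compl HC) (A j)"
      "\<And>h k. h \<in> HC \<Longrightarrow> k \<in> orth_compl HC \<Longrightarrow> E j (h + k) = C j h + (B j h + A j k)"
    using lifting unfolding coisometric_lifting_def by blast
  define p k where "p = orth_proj HC s" and "k = s - orth_proj HC s"
  have p: "p \<in> HC" and k: "k \<in> orth_compl HC" and s: "s = p + k"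
    using orth_proj[OF C.closed, of s] by (auto simp: p_def k_def)
  have "B j p + A j k \<in> orth_compl HC"
    by (intro closed_csubspaceD(3)[OF closed_csubspace_orth_compl] bounded_opD(1)[OF BA(1) p]
        bounded_opD(1)[OF BA(2) k])
  then have "cinner (B j p + A j k) h = 0"
    using h cinner_eq_zero_commute by (auto simp: orth_compl_def)
  then have "cinner (E j s) h = cinner (C j p) h"
    by (simp add: s BA(3)[OF p k] cinner_add_left[of "C j p"])
  also have "\<dots> = cinner p (adj HC (C j) h)"
    by (rule adj(2)[OF C.closed C.bounded p])
  also have "\<dots> = cinner s (adj HC (C j) h)"
    using k adj(1)[OF C.closed C.bounded, of j h] cinner_eq_zero_commute
    by (auto simp: s cinner_add_left orth_compl_def)
  finally show "cinner (E j s) h = cinner s (adj HC (C j) h)" .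
qed simp

lemma HP_space_level_E: "HP_space HC n \<subseteq> level_space UNIV E n"
  using E.HP_space_subset[of n] by (auto simp: HP_space_def)

text \<open>
  This is where the lifting property enters: on \<open>H\<^sub>C \<otimes> \<P>\<^bsub>[1,n]\<^esub>\<close>, where the defect components vanish,
  the step operators of \<open>C\<close> and \<open>E\<close> involve only the adjoints of the tuples and hence agree.
\<close>

lemma U_op_lifting:
  assumes z: "z \<in> HP_space HC n"
  shows "U_op HC C (Suc n) z = U_op UNIV E (Suc n) z"
proof -
  obtain f where f: "z = (f, 0)" using z by (auto simp: HP_space_def)
  have zC: "(f, 0) \<in> level_space HC C n" and zE: "(f, 0) \<in> level_space UNIV E n"
    using z C.HP_space_subset[of n] HP_space_level_E[of n] by (auto simp: f)
  have "coord f w \<in> HC" for w using z by (simp add: f HP_space_def)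
  then have "C.star (coord f w) = E.star (coord f w)" for w
    by (simp add: C.star_def E.star_def adj_lifting)
  then show ?thesis
    unfolding f by (intro prod_eqI ell2_cong)
      (simp_all add: C.coord_fst_U_op[OF zC] E.coord_fst_U_op[OF zE] coord_U_op(2))
qed

text \<open>
  The approximants of the adjoint of the limit in the theorem.
\<close>

definition V :: "nat \<Rightarrow> ('d, 'a) ambient \<Rightarrow> ('d, 'a) ambient" where
  "V n x = U_adj_prod UNIV E n (U_prod HC C n (Q_proj HC C n x))"

lemma U_prod_Q_proj: "U_prod HC C n (Q_proj HC C n x) \<in> HP_space HC n"
  by (rule C.U_prod_Q_space[OF C.Q_proj_in])

lemma Q_space_mono: "x \<in> C.Q_space n \<Longrightarrow> n \<le> m \<Longrightarrow> x \<in> C.Q_space m"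
  by auto

lemma Q_proj_Q_space:
  assumes "x \<in> C.Q_space n"
  shows "Q_proj HC C n x = x"
  unfolding Q_proj_def
  by (rule orth_proj_eqI[OF C.Q_space_closed assms]) (simp add: orth_compl_def)

text \<open>
  Once the truncated vector has been carried into \<open>H\<^sub>C \<otimes> \<P>\<^bsub>[1,n]\<^esub>\<close>, a further step forward with \<open>C\<close> is
  undone by the corresponding step backward with \<open>E\<close>.
\<close>

lemma U_adj_prod_U_prod_stable:
  assumes x: "x \<in> C.Q_space n"
  shows "U_adj_prod UNIV E (Suc n) (U_prod HC C (Suc n) x) = U_adj_prod UNIV E n (U_prod HC C n x)"
proof -
  have z: "U_prod HC C n x \<in> HP_space HC n" by (rule C.U_prod_Q_space[OF x])
  then have "U_prod HC C n x \<in> level_space UNIV E n" using HP_space_level_E by blast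
  then show ?thesis
    by (simp add: U_op_lifting[OF z] unitary_op_adj[OF E.level_closed E.unitary_U_op])
qed

lemma V_Q_proj:
  assumes "n \<le> m"
  shows "V m (Q_proj HC C n x) = V n x"
  using assms
proof (induction m rule: dec_induct)
  case base
  show ?case by (simp add: V_def Q_proj_Q_space[OF C.Q_proj_in])
next
  case (step m)
  have "Q_proj HC C n x \<in> C.Q_space m" "Q_proj HC C n x \<in> C.Q_space (Suc m)"
    using Q_space_mono[OF C.Q_proj_in] step by (meson le_SucI order.order_iff_strict)+
  then have "V (Suc m) (Q_proj HC C n x) = V m (Q_proj HC C n x)"
    unfolding V_def by (simp only: Q_proj_Q_space U_adj_prod_U_prod_stable)
  then show ?case using step by simp
qed

lemma isometry_U_prod: "isometry_op (hat_space HC C) (level_space HC C n) (U_prod HC C n)"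
  using C.unitary_U_prod by (simp add: unitary_op_def)

lemma bounded_V: "bounded_op (hat_space HC C) (hat_space UNIV E) (V n)"
proof -
  have "bounded_op (hat_space HC C) (C.Q_space n) (Q_proj HC C n)"
  proof (rule bounded_op_restrict)
    show "bounded_op UNIV (C.Q_space n) (Q_proj HC C n)"
      unfolding Q_proj_def by (rule bounded_orth_proj[OF C.Q_space_closed])
    show "Q_proj HC C n ` hat_space HC C \<subseteq> C.Q_space n"
      by (rule image_subsetI) (rule C.Q_proj_in)
  qed simp
  moreover have "bounded_op (C.Q_space n) (level_space UNIV E n) (U_prod HC C n)"
  proof (rule bounded_op_restrict)
    show "bounded_op (hat_space HC C) (level_space HC C n) (U_prod HC C n)"
      using isometry_U_prod by (simp add: isometry_op_def)
    show "C.Q_space n \<subseteq> hat_space HC C" by auto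
    show "U_prod HC C n ` C.Q_space n \<subseteq> level_space UNIV E n"
      using C.U_prod_Q_space HP_space_level_E by blast
  qed
  moreover have "bounded_op (level_space UNIV E n) (hat_space UNIV E) (U_adj_prod UNIV E n)"
    using E.isometry_U_adj_prod by (simp add: isometry_op_def)
  ultimately have "bounded_op (hat_space HC C) (hat_space UNIV E)
      (U_adj_prod UNIV E n \<circ> (U_prod HC C n \<circ> Q_proj HC C n))"
    by (intro bounded_op_comp)
  then show ?thesis by (simp add: V_def[abs_def] comp_def)
qed

lemma norm_Q_proj_le: "norm (Q_proj HC C n x) \<le> norm x"
  unfolding Q_proj_def by (rule norm_orth_proj_le[OF C.Q_space_closed])

lemma norm_V: "norm (V n x) = norm (Q_proj HC C n x)"
proof -
  have "U_prod HC C n (Q_proj HC C n x) \<in> level_space UNIV E n"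
    using U_prod_Q_proj HP_space_level_E by blast
  then show ?thesis
    using E.isometry_U_adj_prod isometry_U_prod C.Q_proj_in_hat by (simp add: V_def isometry_op_def)
qed

text \<open>
  The approximants of the two limits are adjoint to each other.  The projection that \<open>V n\<close> applies
  first is not visible on the left-hand side: what it removes from \<open>s\<close> stays in the Fock space
  component through all \<open>n\<close> steps, which is orthogonal to \<open>H\<^sub>C \<otimes> \<P>\<^bsub>[1,n]\<^esub>\<close>.
\<close>

lemma cinner_V:
  assumes x: "x \<in> hat_space UNIV E" and s: "s \<in> hat_space HC C"
  shows "cinner s (U_adj_prod HC C n (P_proj HC n (U_prod UNIV E n x))) = cinner (V n s) x"
proof -
  let ?q = "Q_proj HC C n s"
  define u where "u = P_proj HC n (U_prod UNIV E n x)"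
  have HP: "closed_csubspace (HP_space HC n :: ('d, 'a) ambient set)"
    by (rule closed_csubspace_HP_space[OF C.closed])
  have u: "u \<in> HP_space HC n"
    unfolding u_def P_proj_def by (rule orth_proj(1)[OF HP])
  have "fst (U_prod HC C n s) = fst (U_prod HC C n ?q)"
    by (rule fst_U_prod_cong) (simp_all add: C.Q_proj_eq[OF s] coord_trunc)
  moreover have "snd u = 0" using u by (auto simp: HP_space_def)
  ultimately have "cinner (U_prod HC C n s) u = cinner (U_prod HC C n ?q) u"
    by (simp add: cinner_prod_def)
  also have "\<dots> = cinner (U_prod HC C n ?q) (U_prod UNIV E n x)"
    unfolding u_def P_proj_def by (rule cinner_orth_proj_right[OF HP U_prod_Q_proj])
  also have "\<dots> = cinner (V n s) x"
  proof -
    have "U_prod HC C n ?q \<in> level_space UNIV E n" using U_prod_Q_proj HP_space_level_E by blast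
    from E.cinner_U_prod[OF x this] show ?thesis unfolding V_def by (metis cinner_commute)
  qed
  finally show ?thesis
    using C.cinner_U_prod[OF s] u C.HP_space_subset unfolding u_def by (metis subsetD)
qed

lemma U_adj_prod_P_proj_in:
  "U_adj_prod HC C n (P_proj HC n x) \<in> hat_space HC C"
  unfolding P_proj_def
  by (intro C.U_adj_prod(1) subsetD[OF C.HP_space_subset] orth_proj(1) closed_csubspace_HP_space C.closed)

end

theorem theorem2p1:
  fixes HC :: "'a::chilbert_space set"
    and C E :: "'d::finite \<Rightarrow> 'a \<Rightarrow> 'a"
  assumes "closed_csubspace HC"
    and "coisometric_tuple HC C"
    and "coisometric_lifting HC C E"
  shows "\<exists>W. sot_lim (hat_space UNIV E)
        (\<lambda>n. U_adj_prod HC C n \<circ> P_proj HC n \<circ> U_prod UNIV E n) W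
    \<and> coisometry_op (hat_space UNIV E) (hat_space HC C) W
    \<and> sot_lim (hat_space HC C)
        (\<lambda>n. U_adj_prod UNIV E n \<circ> U_prod HC C n \<circ> Q_proj HC C n)
        (adj (hat_space UNIV E) W)"
proof -
  interpret lifting HC C E
    using assms closed_csubspace_UNIV
    by unfold_locales (auto simp: coisometric_lifting_def)
  let ?S = "hat_space HC C" and ?S' = "hat_space UNIV E"
  obtain L where L: "isometry_op ?S ?S' L" "\<And>x. x \<in> ?S \<Longrightarrow> (\<lambda>n. V n x) \<longlonglongrightarrow> L x"
      "\<And>x n. x \<in> ?S \<Longrightarrow> L (Q_proj HC C n x) = V n x"
    using isometry_op_limit[where Q = "Q_proj HC C", OF C.hat_closed E.hat_closed C.Q_proj_in_hat
        norm_Q_proj_le C.Q_proj_tendsto bounded_V norm_V V_Q_proj] by blast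
  have bL: "bounded_op ?S ?S' L" using L(1) by (simp add: isometry_op_def)
  define W where "W = adj ?S L"
  have W: "bounded_op ?S' ?S W"
    unfolding W_def by (rule adj_bounded_op[OF C.hat_closed bL])
  have LW: "cinner (L s) y = cinner s (W y)" if "s \<in> ?S" for s y
    unfolding W_def by (rule adj(2)[OF C.hat_closed bL that])
  have adjW: "adj ?S' W s = L s" if s: "s \<in> ?S" for s
  proof (rule adj_eqI[OF E.hat_closed])
    show "L s \<in> ?S'" by (rule bounded_opD(1)[OF bL s])
    show "cinner (W y) s = cinner y (L s)" for y using LW[OF s, of y] by (metis cinner_commute)
  qed
  \<comment> \<open>The identity \<open>V n = L \<circ> Q n\<close> after taking adjoints on both sides.\<close>
  have "U_adj_prod HC C n (P_proj HC n (U_prod UNIV E n x)) = Q_proj HC C n (W x)"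
    if x: "x \<in> ?S'" for n x
  proof (rule cinner_right_eqI[OF C.hat_closed U_adj_prod_P_proj_in C.Q_proj_in_hat])
    fix s assume s: "s \<in> ?S"
    have "cinner s (U_adj_prod HC C n (P_proj HC n (U_prod UNIV E n x)))
        = cinner (Q_proj HC C n s) (W x)"
      by (simp add: cinner_V[OF x s] L(3)[OF s, symmetric] LW C.Q_proj_in_hat)
    also have "\<dots> = cinner (Q_proj HC C n s) (Q_proj HC C n (W x))"
      unfolding Q_proj_def
      by (rule cinner_orth_proj_right[OF C.Q_space_closed orth_proj(1)[OF C.Q_space_closed], symmetric])
    also have "\<dots> = cinner s (Q_proj HC C n (W x))"
      unfolding Q_proj_def by (rule cinner_orth_proj_left[OF C.Q_space_closed orth_proj(1)[OF C.Q_space_closed]])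
    finally show "cinner s (U_adj_prod HC C n (P_proj HC n (U_prod UNIV E n x)))
        = cinner s (Q_proj HC C n (W x))" .
  qed
  then have "sot_lim ?S' (\<lambda>n. U_adj_prod HC C n \<circ> P_proj HC n \<circ> U_prod UNIV E n) W"
    using C.Q_proj_tendsto bounded_opD(1)[OF W] by (simp add: sot_lim_def)
  moreover have "isometry_op ?S ?S' (adj ?S' W)"
    using adj_bounded_op[OF E.hat_closed W] L(1) adjW by (simp add: isometry_op_def)
  moreover have "sot_lim ?S (\<lambda>n. U_adj_prod UNIV E n \<circ> U_prod HC C n \<circ> Q_proj HC C n) (adj ?S' W)"
    using L(2) adjW by (simp add: sot_lim_def V_def)
  ultimately show ?thesis using W by (auto simp: coisometry_op_def)
qed

end
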